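(* Consider a Weingarten cube with vertices $x_1,\dots,x_4,\tilde x_1,\dots,\tilde x_4$, with crosses $(p_{12},p_{23},p_{34},p_{41})$ and $(\tilde p_{12},\tilde p_{23},\tilde p_{34},\tilde p_{41})$ adapted to the opposite faces $Q=(x_1,\dots,x_4)$ and $\tilde Q=(\tilde x_1,\dots,\tilde x_4)$. Then the hyperboloids $h$ and $\tilde h$ determined by the two crosses form a (classical) Weingarten pair. In particular, the cross centres $q\in h$ and $\tilde q\in\tilde h$ are corresponding points.
   Context: All points lie in $\mathbb{R}^3$, regarded as the affine part of $\mathbb{R}\mathrm{P}^3$; intersection points may be at infinity. $\operatorname{inc}[\cdot]$ denotes the subspace spanned by the given points. An A-cube is a combinatorial cube with faces $(x_1,x_2,x_3,x_4)$, $(\tilde x_1,\tilde x_2,\tilde x_3,\tilde x_4)$, $(x_i,x_{i+1},\tilde x_{i+1},\tilde x_i)$ (indices modulo 4), all faces skew (non-coplanar) quadrilaterals, and with planar vertex stars (each vertex is coplanar with its three neighbours). A cross adapted to a skew quadrilateral $(x_1,x_2,x_3,x_4)$ is a quadruple of coplanar points $p_{12},p_{23},p_{34},p_{41}$, with $p_{ij}\in\operatorname{inc}[x_i,x_j]$ different from $x_i,x_j$. Its centre is $\operatorname{inc}[p_{12},p_{34}]\cap\operatorname{inc}[p_{23},p_{41}]$. A hyperboloid is a doubly ruled quadric (one-sheeted hyperboloid or hyperbolic paraboloid); its asymptotic lines are its rulings. The hyperboloid determined by a cross is the unique hyperboloid containing the four extended edges of the quadrilateral and the two lines of the cross. A Weingarten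 cube is an A-cube with crosses adapted to the two opposite faces $Q,\tilde Q$ such that for all $i$ and $(j,k,l)=(i+1,i+2,i+3)$ modulo 4, $$\operatorname{inc}[p_{ij},\tilde p_{ij}]=\operatorname{inc}[x_i,x_j,p_{kl}]\cap\operatorname{inc}[\tilde x_i,\tilde x_j,\tilde p_{kl}].$$ Classical Weingarten pair: two surfaces parametrized along asymptotic lines over the same domain (so that there is a correspondence $y\mapsto T(y)=\tilde y$ between their points preserving asymptotic lines) such that the line $\operatorname{inc}[y,\tilde y]$ connecting corresponding points is the intersection of the tangent planes to the two surfaces at $y$ and $\tilde y$. This condition is understood at pairs of corresponding points which are distinct and have distinct tangent planes (generic situation). *)

theory Defs
  imports "HOL-Analysis.Analysis"
begin

text \<open>
  A projective subspace of the real projective 3-space is represented by the corresponding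
  linear subspace of \<^typ>\<open>real^4\<close>; points, lines and planes are those of linear
  dimension 1, 2 and 3, and incidence is inclusion. Cyclic indices \<open>1, 2, 3, 4\<close>
  are the elements of the type \<^typ>\<open>4\<close> of integers modulo 4 (where \<open>4 = 0\<close>).
\<close>

definition proj_point :: "(real^4) set \<Rightarrow> bool" where
  "proj_point P \<longleftrightarrow> subspace P \<and> dim P = 1"

definition proj_line :: "(real^4) set \<Rightarrow> bool" where
  "proj_line l \<longleftrightarrow> subspace l \<and> dim l = 2"

definition inc :: "(real^4) set set \<Rightarrow> (real^4) set" where
  "inc S = span (\<Union>S)"

definition aff :: "real^3 \<Rightarrow> (real^4) set" where
  "aff v = span {vector [v$1, v$2, v$3, 1]}"


subsection \<open>Weingarten cubes\<close>

definition A_cube :: "(4 \<Rightarrow> real^3) \<Rightarrow> (4 \<Rightarrow> real^3) \<Rightarrow> bool" where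
  "A_cube x xt \<longleftrightarrow>
     \<not> coplanar {x 1, x 2, x 3, x 4} \<and>
     \<not> coplanar {xt 1, xt 2, xt 3, xt 4} \<and>
     (\<forall>i. \<not> coplanar {x i, x (i + 1), xt (i + 1), xt i}) \<and>
     (\<forall>i. coplanar {x i, x (i - 1), x (i + 1), xt i}) \<and>
     (\<forall>i. coplanar {xt i, xt (i - 1), xt (i + 1), x i})"

text \<open>
  The value \<open>p i\<close> is the cross point on the extended edge from \<open>x i\<close> to
  \<open>x (i + 1)\<close>, so \<open>p 1, p 2, p 3, p 4\<close> stand for
  \<open>p\<^sub>1\<^sub>2, p\<^sub>2\<^sub>3, p\<^sub>3\<^sub>4, p\<^sub>4\<^sub>1\<close>. The vertices are affine, whereas cross points
  may lie at infinity.
\<close>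

definition adapted_cross :: "(4 \<Rightarrow> real^3) \<Rightarrow> (4 \<Rightarrow> (real^4) set) \<Rightarrow> bool" where
  "adapted_cross x p \<longleftrightarrow>
     (\<forall>i. proj_point (p i) \<and> p i \<subseteq> inc {aff (x i), aff (x (i + 1))} \<and>
          p i \<noteq> aff (x i) \<and> p i \<noteq> aff (x (i + 1))) \<and>
     dim (inc {p 1, p 2, p 3, p 4}) \<le> 3"

definition cross_centre :: "(4 \<Rightarrow> (real^4) set) \<Rightarrow> (real^4) set" where
  "cross_centre p = inc {p 1, p 3} \<inter> inc {p 2, p 4}"

definition Weingarten_cube ::
    "(4 \<Rightarrow> real^3) \<Rightarrow> (4 \<Rightarrow> real^3) \<Rightarrow> (4 \<Rightarrow> (real^4) set) \<Rightarrow> (4 \<Rightarrow> (real^4) set) \<Rightarrow> bool" where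
  "Weingarten_cube x xt p pt \<longleftrightarrow>
     A_cube x xt \<and> adapted_cross x p \<and> adapted_cross xt pt \<and>
     (\<forall>i. inc {p i, pt i} =
          inc {aff (x i), aff (x (i + 1)), p (i + 2)} \<inter>
          inc {aff (xt i), aff (xt (i + 1)), pt (i + 2)})"


subsection \<open>Hyperboloids\<close>

definition points_of :: "(real^4) set \<Rightarrow> (real^4) set set" where
  "points_of l = {P. proj_point P \<and> P \<subseteq> l}"

definition quadric :: "real^4^4 \<Rightarrow> (real^4) set set" where
  "quadric A = {P. proj_point P \<and> (\<forall>y\<in>P. y \<bullet> (A *v y) = 0)}"

definition rulings :: "(real^4) set set \<Rightarrow> (real^4) set set" where
  "rulings h = {l. proj_line l \<and> points_of l \<subseteq> h}"

text \<open>
  Doubly ruled quadrics: exactly two lines of the quadric pass through each of its points.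
  This singles out the quadrics of signature (2,2), whose affine parts are the one-sheeted
  hyperboloids and the hyperbolic paraboloids.
\<close>

definition hyperboloid :: "(real^4) set set \<Rightarrow> bool" where
  "hyperboloid h \<longleftrightarrow>
     (\<exists>A. A \<noteq> 0 \<and> transpose A = A \<and> h = quadric A) \<and> h \<noteq> {} \<and>
     (\<forall>P\<in>h. card {l \<in> rulings h. P \<subseteq> l} = 2)"

definition cross_hyperboloid ::
    "(4 \<Rightarrow> real^3) \<Rightarrow> (4 \<Rightarrow> (real^4) set) \<Rightarrow> (real^4) set set" where
  "cross_hyperboloid x p =
     (THE h. hyperboloid h \<and>
        (\<forall>i. points_of (inc {aff (x i), aff (x (i + 1))}) \<subseteq> h) \<and>
        points_of (inc {p 1, p 3}) \<subseteq> h \<and> points_of (inc {p 2, p 4}) \<subseteq> h)"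


subsection \<open>Classical Weingarten pairs\<close>

text \<open>
  A surface is parametrized in homogeneous coordinates: the map \<open>F\<close> into \<^typ>\<open>real^4\<close>
  represents the points \<open>span {F u v}\<close>.
\<close>

definition du :: "(real \<Rightarrow> real \<Rightarrow> real^4) \<Rightarrow> real \<Rightarrow> real \<Rightarrow> real^4" where
  "du F u v = vector_derivative (\<lambda>s. F s v) (at u)"

definition dv :: "(real \<Rightarrow> real \<Rightarrow> real^4) \<Rightarrow> real \<Rightarrow> real \<Rightarrow> real^4" where
  "dv F u v = vector_derivative (\<lambda>t. F u t) (at v)"

primrec Ck_on :: "nat \<Rightarrow> (real \<times> real) set \<Rightarrow> (real \<Rightarrow> real \<Rightarrow> real^4) \<Rightarrow> bool" where
  "Ck_on 0 D F \<longleftrightarrow> continuous_on D (\<lambda>(u, v). F u v)"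
| "Ck_on (Suc k) D F \<longleftrightarrow>
     (\<forall>(u, v)\<in>D. (\<lambda>s. F s v) differentiable (at u) \<and> (\<lambda>t. F u t) differentiable (at v)) \<and>
     Ck_on k D (du F) \<and> Ck_on k D (dv F)"

definition smooth_on :: "(real \<times> real) set \<Rightarrow> (real \<Rightarrow> real \<Rightarrow> real^4) \<Rightarrow> bool" where
  "smooth_on D F \<longleftrightarrow> (\<forall>k. Ck_on k D F)"

definition tangent_plane :: "(real \<Rightarrow> real \<Rightarrow> real^4) \<Rightarrow> real \<Rightarrow> real \<Rightarrow> (real^4) set" where
  "tangent_plane F u v = span {F u v, du F u v, dv F u v}"

text \<open>
  Regular parametrizations of the whole surface \<open>S\<close> whose parameter curves are asymptotic,
  i.e. have their osculating planes in the tangent planes of the surface. On a hyperboloid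
  these curves run along the rulings. The map \<open>F\<close> need not be injective.
\<close>

definition asymptotic_parametrization ::
    "(real \<times> real) set \<Rightarrow> (real \<Rightarrow> real \<Rightarrow> real^4) \<Rightarrow> (real^4) set set \<Rightarrow> bool" where
  "asymptotic_parametrization D F S \<longleftrightarrow>
     open D \<and> smooth_on D F \<and>
     (\<forall>(u, v)\<in>D. dim (tangent_plane F u v) = 3 \<and>
        du (du F) u v \<in> tangent_plane F u v \<and>
        dv (dv F) u v \<in> tangent_plane F u v) \<and>
     S = (\<lambda>(u, v). span {F u v}) ` D"

definition Weingarten_pair ::
    "(real^4) set set \<Rightarrow> (real^4) set set \<Rightarrow> ((real^4) set \<Rightarrow> (real^4) set) \<Rightarrow> bool" where
  "Weingarten_pair S St T \<longleftrightarrow>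
     bij_betw T S St \<and>
     (\<exists>D F Ft. asymptotic_parametrization D F S \<and> asymptotic_parametrization D Ft St \<and>
        (\<forall>(u, v)\<in>D. T (span {F u v}) = span {Ft u v} \<and>
           (span {F u v} \<noteq> span {Ft u v} \<and> tangent_plane F u v \<noteq> tangent_plane Ft u v \<longrightarrow>
              inc {span {F u v}, span {Ft u v}} =
                tangent_plane F u v \<inter> tangent_plane Ft u v)))"

definition preserves_rulings ::
    "(real^4) set set \<Rightarrow> (real^4) set set \<Rightarrow> ((real^4) set \<Rightarrow> (real^4) set) \<Rightarrow> bool" where
  "preserves_rulings h ht T \<longleftrightarrow>
     (\<forall>l\<in>rulings h. \<exists>lt\<in>rulings ht. T ` points_of l = points_of lt)"

end

theory Submission
  imports Defs
begin

text \<open>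
  Choose homogeneous representatives \<open>Y i\<close> of the vertices such that \<open>p i\<close> is spanned by
  \<open>Y i + Y (i + 1)\<close>. In the basis \<open>Y\<close> the hyperboloid of the cross is \<open>y\<^sub>1 y\<^sub>3 = y\<^sub>2 y\<^sub>4\<close>, with centre
  \<open>(1, 1, 1, 1)\<close>, and it is parametrized along its rulings by
  \<open>(cos u cos v, sin u cos v, sin u sin v, cos u sin v)\<close>. The correspondence is the projective map
  taking the frame \<open>Y\<close> to the frame \<open>Yt\<close> of the opposite face.

  That the image of a point lies in the tangent plane at that point is a biquadratic condition
  in the two ruling parameters. Its four corner coefficients vanish by planarity of the vertex
  stars of the first face, the four edge coefficients by the Weingarten condition at the cross
  points, and the middle one because the vertex stars of the opposite face are planar too and
  the side faces are skew.
\<close>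

section \<open>Linear algebra in homogeneous coordinates\<close>

lemma vector_4 [simp]:
  "(vector [a, b, c, d] :: ('a::zero)^4) $ 1 = a"
  "(vector [a, b, c, d] :: ('a::zero)^4) $ 2 = b"
  "(vector [a, b, c, d] :: ('a::zero)^4) $ 3 = c"
  "(vector [a, b, c, d] :: ('a::zero)^4) $ 4 = d"
  unfolding vector_def by (simp_all add: numeral_eq_Suc)

lemma vec4_eq_iff: "(x :: 'a^4) = y \<longleftrightarrow> x$1 = y$1 \<and> x$2 = y$2 \<and> x$3 = y$3 \<and> x$4 = y$4"
  by (simp add: vec_eq_iff forall_4)

lemma in_span_2:
  "v \<in> span {a, b} \<longleftrightarrow> (\<exists>\<alpha> \<beta>. v = \<alpha> *\<^sub>R a + \<beta> *\<^sub>R b)"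
  by (simp add: span_breakdown_eq[of v] span_singleton image_iff algebra_simps)

lemma in_span_3:
  "v \<in> span {a, b, c} \<longleftrightarrow> (\<exists>\<alpha> \<beta> \<gamma>. v = \<alpha> *\<^sub>R a + \<beta> *\<^sub>R b + \<gamma> *\<^sub>R c)"
  by (simp add: span_breakdown_eq[of v] in_span_2 algebra_simps)

text \<open>Read as the matrix with columns \<open>Y 1\<close> to \<open>Y 4\<close>. Injectivity of
  \<open>comb Y\<close> says that these vectors form a basis, as a family rather than as a set, so
  coinciding vectors need no separate treatment.\<close>

definition comb :: "(4 \<Rightarrow> 'a::real_vector) \<Rightarrow> real^4 \<Rightarrow> 'a" where
  "comb Y z = z$1 *\<^sub>R Y 1 + z$2 *\<^sub>R Y 2 + z$3 *\<^sub>R Y 3 + z$4 *\<^sub>R Y 4"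

lemma linear_comb: "linear (comb Y)"
  by (rule linearI) (simp_all add: comb_def algebra_simps)

lemma comb_in_span: "comb Y z \<in> span {Y 1, Y 2, Y 3, Y 4}"
  unfolding comb_def by (intro span_add span_scale span_base) auto

lemma bij_comb:
  fixes Y :: "4 \<Rightarrow> real^4"
  assumes "inj (comb Y)"
  shows "bij (comb Y)"
  using assms linear_injective_imp_surjective[OF linear_comb assms] by (simp add: bij_def)

lemma inj_combI:
  assumes "\<And>a b c d. a *\<^sub>R Y 1 + b *\<^sub>R Y 2 + c *\<^sub>R Y 3 + d *\<^sub>R Y 4 = 0
    \<Longrightarrow> a = 0 \<and> b = 0 \<and> c = 0 \<and> d = 0"
  shows "inj (comb Y)"
  unfolding linear_injective_0[OF linear_comb]
  using assms by (auto simp: comb_def vec4_eq_iff)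

lemma inj_combD:
  assumes "inj (comb Y)"
    and "a *\<^sub>R Y 1 + b *\<^sub>R Y 2 + c *\<^sub>R Y 3 + d *\<^sub>R Y 4 = 0"
  shows "a = 0 \<and> b = 0 \<and> c = 0 \<and> d = 0"
proof -
  have "comb Y (vector [a, b, c, d]) = 0"
    using assms(2) by (simp add: comb_def)
  then have "vector [a, b, c, d] = (0 :: real^4)"
    using assms(1) unfolding linear_injective_0[OF linear_comb] by blast
  then show ?thesis
    by (simp add: vec4_eq_iff)
qed

text \<open>An injective \<open>comb Y\<close> is onto, so \<open>S\<close> would span the whole
  space. Its use is to turn a dimension bound into a nontrivial linear relation among four given
  vectors.\<close>

lemma not_inj_comb:
  fixes Y :: "4 \<Rightarrow> real^4"
  assumes "Y 1 \<in> S" "Y 2 \<in> S" "Y 3 \<in> S" "Y 4 \<in> S" "dim S \<le> 3"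
  shows "\<not> inj (comb Y)"
proof
  assume "inj (comb Y)"
  then have "UNIV = range (comb Y)"
    using bij_comb[of Y] by (simp add: bij_def)
  also have "\<dots> \<subseteq> span S"
    using comb_in_span[of Y] span_mono[of "{Y 1, Y 2, Y 3, Y 4}" S] assms by auto
  finally have "dim (UNIV :: (real^4) set) \<le> dim S"
    by (metis dim_span dim_subset)
  then show False
    using assms by simp
qed

lemma inc_span: "inc (span ` F) = span (\<Union>F)"
  unfolding inc_def
proof
  have "\<Union> (span ` F) \<subseteq> span (\<Union>F)"
    by (intro UN_least span_mono Union_upper)
  then show "span (\<Union> (span ` F)) \<subseteq> span (\<Union>F)"
    by (simp add: span_minimal)
  show "span (\<Union>F) \<subseteq> span (\<Union> (span ` F))"
    using span_superset by (intro span_mono) blast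
qed

lemma inc_points:
  "inc {span {a}, span {b}} = span {a, b}"
  "inc {span {a}, span {b}, span {c}} = span {a, b, c}"
  "inc {span {a}, span {b}, span {c}, span {d}} = span {a, b, c, d}"
  using inc_span[of "{{a}, {b}}"] inc_span[of "{{a}, {b}, {c}}"]
    inc_span[of "{{a}, {b}, {c}, {d}}"]
  by (simp_all add: insert_commute)

lemma dim_span_le_3: "dim {a, b, c :: 'a::euclidean_space} \<le> 3"
proof -
  have "dim {a, b, c} \<le> card {a, b, c}"
    by (rule dim_le_card) (auto intro: span_base)
  also have "\<dots> \<le> 3"
    by (simp add: card_insert_if)
  finally show ?thesis .
qed

section \<open>Lifts of affine points and coplanarity\<close>

definition lift :: "real^3 \<Rightarrow> real^4" where
  "lift v = vector [v$1, v$2, v$3, 1]"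

lemma aff_lift: "aff v = span {lift v}"
  by (simp add: aff_def lift_def)

lemma lift_affine:
  assumes "u + v + w = 1"
  shows "lift (u *\<^sub>R a + v *\<^sub>R b + w *\<^sub>R c) = u *\<^sub>R lift a + v *\<^sub>R lift b + w *\<^sub>R lift c"
  using assms by (simp add: lift_def vec4_eq_iff)

text \<open>The last coordinate of every lift is 1, so the coefficients of the relation sum to zero.
  Dividing by \<delta> therefore gives \<open>d\<close> as an affine combination of the other three
  points.\<close>

lemma coplanar_lift_last:
  assumes "\<alpha> *\<^sub>R lift a + \<beta> *\<^sub>R lift b + \<gamma> *\<^sub>R lift c + \<delta> *\<^sub>R lift d = 0" "\<delta> \<noteq> 0"
  shows "coplanar {a, b, c, d}"
proof -
  have s: "\<delta> = - \<alpha> - \<beta> - \<gamma>" and c: "\<alpha> * a$i + \<beta> * b$i + \<gamma> * c$i + \<delta> * d$i = 0" for i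
    using assms(1) exhaust_3[of i] by (auto simp: lift_def vec4_eq_iff)
  define u v w where "u = - \<alpha> / \<delta>" and "v = - \<beta> / \<delta>" and "w = - \<gamma> / \<delta>"
  have d: "d = u *\<^sub>R a + v *\<^sub>R b + w *\<^sub>R c"
    unfolding vec_eq_iff u_def v_def w_def
  proof
    fix i
    have "\<delta> * d$i = - \<alpha> * a$i - \<beta> * b$i - \<gamma> * c$i"
      using c[of i] by simp
    then show "d $ i = ((- \<alpha> / \<delta>) *\<^sub>R a + (- \<beta> / \<delta>) *\<^sub>R b + (- \<gamma> / \<delta>) *\<^sub>R c) $ i"
      using \<open>\<delta> \<noteq> 0\<close> by (simp add: field_simps)
  qed
  have "\<delta> * (u + v + w) = \<delta>"
    using \<open>\<delta> \<noteq> 0\<close> s unfolding u_def v_def w_def distrib_left by simp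
  then have "u + v + w = 1"
    using \<open>\<delta> \<noteq> 0\<close> by simp
  with d have "d \<in> affine hull {a, b, c}"
    by (auto simp: affine_hull_3)
  then have "{a, b, c, d} \<subseteq> affine hull {a, b, c}"
    by (auto intro: hull_inc)
  then show ?thesis
    unfolding coplanar_def by blast
qed

lemma not_coplanar_lift:
  assumes "\<not> coplanar {a, b, c, d}"
    and "\<alpha> *\<^sub>R lift a + \<beta> *\<^sub>R lift b + \<gamma> *\<^sub>R lift c + \<delta> *\<^sub>R lift d = 0"
  shows "\<alpha> = 0 \<and> \<beta> = 0 \<and> \<gamma> = 0 \<and> \<delta> = 0"
proof (intro conjI; rule ccontr)
  assume "\<alpha> \<noteq> 0"
  then have "coplanar {d, b, c, a}"
    using assms(2) by (intro coplanar_lift_last[of \<delta> d \<beta> b \<gamma> c \<alpha> a]) (simp_all only: ac_simps not_False_eq_True)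
  then show False using assms(1) by (simp add: insert_commute)
next
  assume "\<beta> \<noteq> 0"
  then have "coplanar {a, d, c, b}"
    using assms(2) by (intro coplanar_lift_last[of \<alpha> a \<delta> d \<gamma> c \<beta> b]) (simp_all only: ac_simps not_False_eq_True)
  then show False using assms(1) by (simp add: insert_commute)
next
  assume "\<gamma> \<noteq> 0"
  then have "coplanar {a, b, d, c}"
    using assms(2) by (intro coplanar_lift_last[of \<alpha> a \<beta> b \<delta> d \<gamma> c]) (simp_all only: ac_simps not_False_eq_True)
  then show False using assms(1) by (simp add: insert_commute)
next
  assume "\<delta> \<noteq> 0"
  then show False using coplanar_lift_last[OF assms(2)] assms(1) by simp
qed

text \<open>An affine plane containing the points lifts into a subspace of dimension at most 3, so
  the four lifts satisfy a nontrivial relation. Since the first three are independent, the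
  coefficient of \<open>lift d\<close> cannot vanish, and the relation can be solved for it.\<close>

lemma coplanar_lift_in_span:
  assumes cop: "coplanar {a, b, c, d}"
    and ind: "\<And>\<alpha> \<beta> \<gamma>. \<alpha> *\<^sub>R lift a + \<beta> *\<^sub>R lift b + \<gamma> *\<^sub>R lift c = 0 \<Longrightarrow> \<alpha> = 0 \<and> \<beta> = 0 \<and> \<gamma> = 0"
  shows "lift d \<in> span {lift a, lift b, lift c}"
proof -
  from cop obtain u v w where uvw: "{a, b, c, d} \<subseteq> affine hull {u, v, w}"
    unfolding coplanar_def by blast
  define S where "S = span {lift u, lift v, lift w}"
  have "lift e \<in> S" if "e \<in> affine hull {u, v, w}" for e
    using that unfolding affine_hull_3 S_def in_span_3 using lift_affine by blast
  then have S: "lift a \<in> S" "lift b \<in> S" "lift c \<in> S" "lift d \<in> S"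
    using uvw by auto
  have "dim S \<le> 3"
    unfolding S_def dim_span by (rule dim_span_le_3)
  define Y where "Y = (\<lambda>i::4. if i = 1 then lift a else if i = 2 then lift b
      else if i = 3 then lift c else lift d)"
  have "\<not> inj (comb Y)"
    by (rule not_inj_comb[of Y S]) (use S \<open>dim S \<le> 3\<close> in \<open>auto simp: Y_def\<close>)
  then obtain z where z: "comb Y z = 0" "z \<noteq> 0"
    unfolding linear_injective_0[OF linear_comb] by blast
  then have eq: "z$1 *\<^sub>R lift a + z$2 *\<^sub>R lift b + z$3 *\<^sub>R lift c + z$4 *\<^sub>R lift d = 0"
    by (simp add: comb_def Y_def)
  have "z$4 \<noteq> 0"
    using eq ind[of "z$1" "z$2" "z$3"] z(2) unfolding vec4_eq_iff by fastforce
  have "lift d = (1 / z$4) *\<^sub>R (z$4 *\<^sub>R lift d)"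
    using \<open>z$4 \<noteq> 0\<close> by simp
  also have "z$4 *\<^sub>R lift d = - (z$1 *\<^sub>R lift a + z$2 *\<^sub>R lift b + z$3 *\<^sub>R lift c)"
    using eq by (simp add: add_eq_0_iff)
  also have "(1 / z$4) *\<^sub>R \<dots> \<in> span {lift a, lift b, lift c}"
    by (intro span_scale span_neg span_add span_base) auto
  finally show ?thesis .
qed

text \<open>Evaluating \<open>i + 1\<close> or \<open>i + 3\<close> at a concrete index runs past 4;
  these rules wrap the literal back to the representatives 1 to 4.\<close>

lemma cyclic_4 [simp]: "(5::4) = 1" "(6::4) = 2" "(7::4) = 3"
  by simp_all

text \<open>Polarization: expanding the form at \<open>w + y\<close> leaves twice the mixed
  term.\<close>

lemma symmetric_matrix_eq_0:
  fixes A :: "real^'n^'n"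
  assumes "transpose A = A" "\<And>y. y \<bullet> (A *v y) = 0"
  shows "A = 0"
proof -
  have sym: "w \<bullet> (A *v y) = y \<bullet> (A *v w)" for w y
    by (metis assms(1) dot_lmul_matrix inner_commute transpose_matrix_vector)
  have "w \<bullet> (A *v y) = 0" for w y
    using assms(2)[of "w + y"] assms(2)[of w] assms(2)[of y] sym[of w y]
    by (simp add: matrix_vector_right_distrib inner_add_left inner_add_right)
  then have "A *v y = 0" for y
    by (metis inner_eq_zero_iff)
  then show ?thesis
    by (metis matrix_eq matrix_vector_mult_0)
qed

section \<open>Points and their homogeneous representatives\<close>

lemma proj_point_span:
  assumes "v \<noteq> 0" shows "proj_point (span {v})"
  using assms by (simp add: proj_point_def dim_eq_card_independent)

lemma proj_pointE:
  assumes "proj_point P"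
  obtains v where "v \<noteq> 0" "P = span {v}"
proof -
  have P: "subspace P" "dim P = 1"
    using assms by (auto simp: proj_point_def)
  then obtain v where v: "v \<in> P" "v \<noteq> 0"
    by (metis dim_eq_0 subset_eq singleton_iff zero_neq_one)
  then have "span {v} = P"
    using P by (intro subspace_dim_equal) (auto simp: dim_eq_card_independent intro: span_minimal[THEN subsetD])
  with v that show thesis by blast
qed

lemma span_singleton_scale:
  assumes "c \<noteq> 0" shows "span {c *\<^sub>R v} = span {v :: 'a::real_vector}"
proof -
  have "v = (1 / c) *\<^sub>R (c *\<^sub>R v)"
    using assms by simp
  then have "v \<in> span {c *\<^sub>R v}"
    by (metis span_base span_scale singletonI)
  then show ?thesis
    by (intro subset_antisym span_minimal) (auto intro: span_base span_scale)
qed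

text \<open>
  The vertices have representatives \<open>Y i\<close> with \<open>p i\<close> spanned by \<open>Y i + Y (i + 1)\<close>:
  coplanarity of the cross points is exactly the solvability of this normalization around the cycle.
\<close>

definition cross_frame :: "(4 \<Rightarrow> real^3) \<Rightarrow> (4 \<Rightarrow> (real^4) set) \<Rightarrow> (4 \<Rightarrow> real^4) \<Rightarrow> bool" where
  "cross_frame x p Y \<longleftrightarrow> inj (comb Y) \<and> (\<forall>i. \<exists>c. c \<noteq> 0 \<and> Y i = c *\<^sub>R lift (x i)) \<and>
     (\<forall>i. p i = span {Y i + Y (i + 1)})"

text \<open>Menelaus' theorem for a skew quadrilateral. A relation among the four coplanar points is
  compared at each vertex; this links consecutive coefficients with a sign change each, and the four
  signs cancel around the cycle.\<close>

lemma cross_product_eq: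
  fixes X :: "4 \<Rightarrow> real^4" and a b :: "4 \<Rightarrow> real"
  assumes inj: "inj (comb X)"
    and dim: "dim (span {a 1 *\<^sub>R X 1 + b 1 *\<^sub>R X 2, a 2 *\<^sub>R X 2 + b 2 *\<^sub>R X 3,
        a 3 *\<^sub>R X 3 + b 3 *\<^sub>R X 4, a 4 *\<^sub>R X 4 + b 4 *\<^sub>R X 1}) \<le> 3"
    and a: "\<And>i::4. a i \<noteq> 0"
  shows "a 1 * a 2 * a 3 * a 4 = b 1 * b 2 * b 3 * b 4"
proof -
  define P where "P i = a i *\<^sub>R X i + b i *\<^sub>R X (i + 1)" for i
  have "\<not> inj (comb P)"
    by (rule not_inj_comb[OF _ _ _ _ dim]) (auto simp: P_def intro: span_base)
  then obtain z where z: "comb P z = 0" "z \<noteq> 0"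
    unfolding linear_injective_0[OF linear_comb] by blast
  have "(z$1 * a 1 + z$4 * b 4) *\<^sub>R X 1 + (z$2 * a 2 + z$1 * b 1) *\<^sub>R X 2 +
      (z$3 * a 3 + z$2 * b 2) *\<^sub>R X 3 + (z$4 * a 4 + z$3 * b 3) *\<^sub>R X 4 = 0"
    using z(1) by (simp add: comb_def P_def algebra_simps)
  from inj_combD[OF inj this]
  have e: "z$1 * a 1 = - (z$4 * b 4)" "z$2 * a 2 = - (z$1 * b 1)"
    "z$3 * a 3 = - (z$2 * b 2)" "z$4 * a 4 = - (z$3 * b 3)"
    by linarith+
  \<comment> \<open>Each equation in \<open>e\<close> passes the vanishing of one coefficient on to
    the next, because the \<open>a i\<close> are nonzero.\<close>
  have "z$1 = 0 \<Longrightarrow> z = 0"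
    using e a unfolding vec4_eq_iff by auto
  then have "z$1 \<noteq> 0" using z(2) by blast
  have "z$1 * (a 1 * a 2 * a 3 * a 4) = z$1 * (b 1 * b 2 * b 3 * b 4)"
    using e by algebra
  with \<open>z$1 \<noteq> 0\<close> show ?thesis by simp
qed

lemma cross_frame_exists:
  assumes inj: "inj (comb (\<lambda>i. lift (x i)))" and cross: "adapted_cross x p"
  obtains Y where "cross_frame x p Y"
proof -
  define X where "X = (\<lambda>i. lift (x i))"
  have "\<exists>a b. a \<noteq> 0 \<and> b \<noteq> 0 \<and> p i = span {a *\<^sub>R X i + b *\<^sub>R X (i + 1)}" for i
  proof -
    have p: "proj_point (p i)" "p i \<subseteq> span {X i, X (i + 1)}"
      "p i \<noteq> span {X i}" "p i \<noteq> span {X (i + 1)}"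
      using cross by (auto simp: adapted_cross_def aff_lift inc_points X_def)
    obtain v where v: "v \<noteq> 0" "p i = span {v}"
      using p(1) by (rule proj_pointE)
    then have "v \<in> span {X i, X (i + 1)}"
      using p(2) span_base by blast
    then obtain a b where ab: "v = a *\<^sub>R X i + b *\<^sub>R X (i + 1)"
      unfolding in_span_2 by blast
    have "a \<noteq> 0"
      using p(4) v ab by (metis add_0 scale_eq_0_iff span_singleton_scale)
    moreover have "b \<noteq> 0"
      using p(3) v ab by (metis add.right_neutral scale_eq_0_iff span_singleton_scale)
    ultimately show ?thesis
      using v ab by blast
  qed
  then obtain a b where ab: "\<And>i. a i \<noteq> 0" "\<And>i. b i \<noteq> 0"
    and p: "\<And>i. p i = span {a i *\<^sub>R X i + b i *\<^sub>R X (i + 1)}"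
    by metis
  have "dim (inc {p 1, p 2, p 3, p 4}) \<le> 3"
    using cross by (simp add: adapted_cross_def)
  then have prod: "a 1 * a 2 * a 3 * a 4 = b 1 * b 2 * b 3 * b 4"
    using inj ab(1) by (intro cross_product_eq[of X]) (simp_all add: p inc_points X_def)
  \<comment> \<open>The scaling solves \<open>a i * c (i + 1) = b i * c i\<close> recursively from
    \<open>c 1 = 1\<close>. The remaining equation, at \<open>i = 4\<close>, closes the cycle and is
    exactly \<open>prod\<close>.\<close>
  define c where "c = (\<lambda>i::4. if i = 1 then 1 else if i = 2 then b 1 / a 1
      else if i = 3 then b 1 * b 2 / (a 1 * a 2) else b 1 * b 2 * b 3 / (a 1 * a 2 * a 3))"
  have c0: "c i \<noteq> 0" for i
    by (simp add: c_def ab)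
  have "\<forall>i. a i * c (i + 1) = b i * c i"
    using prod unfolding forall_4 by (simp add: c_def ab field_simps)
  then have step: "(a i / c i) * c (i + 1) = b i" for i
    using c0[of i] by (metis nonzero_mult_div_cancel_right times_divide_eq_left)
  define Y where "Y i = c i *\<^sub>R X i" for i
  have "p i = span {Y i + Y (i + 1)}" for i
  proof -
    have "a i *\<^sub>R X i + b i *\<^sub>R X (i + 1) = (a i / c i) *\<^sub>R (Y i + Y (i + 1))"
      using c0[of i] step[of i] by (simp add: Y_def scaleR_add_right)
    then show ?thesis
      using span_singleton_scale[of "a i / c i"] ab(1)[of i] c0[of i] p[of i] by simp
  qed
  moreover have "inj (comb Y)"
  proof (rule inj_combI)
    fix s t u v
    assume "s *\<^sub>R Y 1 + t *\<^sub>R Y 2 + u *\<^sub>R Y 3 + v *\<^sub>R Y 4 = 0"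
    then have "(s * c 1) *\<^sub>R X 1 + (t * c 2) *\<^sub>R X 2 + (u * c 3) *\<^sub>R X 3 + (v * c 4) *\<^sub>R X 4 = 0"
      by (simp add: Y_def)
    from inj_combD[OF _ this] show "s = 0 \<and> t = 0 \<and> u = 0 \<and> v = 0"
      using inj c0 by (simp add: X_def)
  qed
  ultimately have "cross_frame x p Y"
    using c0 unfolding cross_frame_def Y_def X_def by blast
  then show thesis ..
qed

text \<open>In frame coordinates the two lines of the cross consist of the vectors
  \<open>(a, a, b, b)\<close> and \<open>(d, c, c, d)\<close>; a common vector has all four
  coordinates equal.\<close>

lemma cross_frame_centre:
  assumes "cross_frame x p Y"
  shows "cross_centre p = span {comb Y (vector [1, 1, 1, 1])}"
proof -
  have inj: "inj (comb Y)" and p: "\<And>i. p i = span {Y i + Y (i + 1)}"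
    using assms by (auto simp: cross_frame_def)
  have "(v \<in> span {Y 1 + Y 2, Y 3 + Y 4} \<and> v \<in> span {Y 2 + Y 3, Y 4 + Y 1}) \<longleftrightarrow>
      v \<in> span {Y 1 + Y 2 + Y 3 + Y 4}" for v
  proof
    assume "v \<in> span {Y 1 + Y 2, Y 3 + Y 4} \<and> v \<in> span {Y 2 + Y 3, Y 4 + Y 1}"
    then obtain a b c d where v: "v = a *\<^sub>R (Y 1 + Y 2) + b *\<^sub>R (Y 3 + Y 4)"
      "v = c *\<^sub>R (Y 2 + Y 3) + d *\<^sub>R (Y 4 + Y 1)"
      unfolding in_span_2 by blast
    then have "(a - d) *\<^sub>R Y 1 + (a - c) *\<^sub>R Y 2 + (b - c) *\<^sub>R Y 3 + (b - d) *\<^sub>R Y 4 = 0"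
      by (simp add: algebra_simps)
    from inj_combD[OF inj this] have "a = b" by simp
    then have "v = a *\<^sub>R (Y 1 + Y 2 + Y 3 + Y 4)"
      using v(1) by (simp add: algebra_simps)
    then show "v \<in> span {Y 1 + Y 2 + Y 3 + Y 4}"
      unfolding span_singleton by blast
  next
    assume "v \<in> span {Y 1 + Y 2 + Y 3 + Y 4}"
    then obtain a where "v = a *\<^sub>R (Y 1 + Y 2 + Y 3 + Y 4)"
      unfolding span_singleton by blast
    then have "v = a *\<^sub>R (Y 1 + Y 2) + a *\<^sub>R (Y 3 + Y 4)" "v = a *\<^sub>R (Y 2 + Y 3) + a *\<^sub>R (Y 4 + Y 1)"
      by (simp_all add: algebra_simps)
    then show "v \<in> span {Y 1 + Y 2, Y 3 + Y 4} \<and> v \<in> span {Y 2 + Y 3, Y 4 + Y 1}"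
      unfolding in_span_2 by blast
  qed
  then show ?thesis
    unfolding cross_centre_def by (auto simp: p inc_points comb_def)
qed

section \<open>Projective transformations of quadrics\<close>

lemma inv_linear_bij:
  fixes f :: "real^4 \<Rightarrow> real^4"
  assumes "linear f" "bij f"
  shows "linear (inv f)" "bij (inv f)" "f (inv f y) = y" "inv f (f y) = y"
    "f ` inv f ` P = P" "inv f ` f ` P = P"
proof -
  show "linear (inv f)" "bij (inv f)"
    using assms by (auto intro: inj_linear_imp_inv_linear bij_imp_bij_inv bij_is_inj)
  show 3: "f (inv f y) = y" and 4: "inv f (f y) = y" for y
    using assms by (simp_all add: bij_def surj_f_inv_f)
  show "f ` inv f ` P = P" "inv f ` f ` P = P"
    by (simp_all add: image_comp comp_def 3 4)
qed

lemma proj_image: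
  fixes f :: "real^4 \<Rightarrow> real^4"
  assumes "linear f" "bij f"
  shows "proj_point P \<Longrightarrow> proj_point (f ` P)" "proj_line P \<Longrightarrow> proj_line (f ` P)"
proof -
  have "dim (f ` P) = dim P"
    using assms by (intro dim_image_eq) (auto simp: bij_def inj_on_def)
  then show "proj_point P \<Longrightarrow> proj_point (f ` P)" "proj_line P \<Longrightarrow> proj_line (f ` P)"
    using assms by (auto simp: proj_point_def proj_line_def linear_subspace_image)
qed

lemma points_of_image:
  fixes f :: "real^4 \<Rightarrow> real^4"
  assumes f: "linear f" "bij f"
  shows "points_of (f ` l) = (`) f ` points_of l"
proof
  show "(`) f ` points_of l \<subseteq> points_of (f ` l)"
    using proj_image(1)[OF f] by (auto simp: points_of_def)
  show "points_of (f ` l) \<subseteq> (`) f ` points_of l"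
  proof
    fix P assume "P \<in> points_of (f ` l)"
    then have "proj_point P" "P \<subseteq> f ` l"
      by (auto simp: points_of_def)
    then have "inv f ` P \<in> points_of l"
      using proj_image(1)[OF inv_linear_bij(1,2)[OF f], of P] inv_linear_bij(4)[OF f]
      by (auto simp: points_of_def)
    then show "P \<in> (`) f ` points_of l"
      using imageI[of "inv f ` P" "points_of l" "(`) f"] inv_linear_bij(5)[OF f, of P] by simp
  qed
qed

lemma rulings_image:
  fixes f :: "real^4 \<Rightarrow> real^4"
  assumes f: "linear f" "bij f"
  shows "rulings ((`) f ` h) = (`) f ` rulings h"
proof
  note g = inv_linear_bij[OF f]
  have inj: "inj ((`) f)"
    using f(2) by (simp add: bij_def inj_image_eq_iff inj_def)
  show "(`) f ` rulings h \<subseteq> rulings ((`) f ` h)"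
    using proj_image(2)[OF f] by (auto simp: rulings_def points_of_image[OF f] intro!: imageI)
  show "rulings ((`) f ` h) \<subseteq> (`) f ` rulings h"
  proof
    fix l assume l: "l \<in> rulings ((`) f ` h)"
    have "points_of (f ` inv f ` l) \<subseteq> (`) f ` h"
      using l by (simp add: rulings_def g(5))
    then have "points_of (inv f ` l) \<subseteq> h"
      unfolding points_of_image[OF f] using inj by (simp add: inj_image_subset_iff)
    then have "inv f ` l \<in> rulings h"
      using l proj_image(2)[OF g(1,2)] by (simp add: rulings_def)
    then show "l \<in> (`) f ` rulings h"
      using imageI[of "inv f ` l" "rulings h" "(`) f"] g(5)[of l] by simp
  qed
qed

lemma in_image_image_iff:
  fixes f :: "real^4 \<Rightarrow> real^4"
  assumes "linear f" "bij f"
  shows "P \<in> (`) f ` S \<longleftrightarrow> inv f ` P \<in> S"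
  using inv_linear_bij(5)[OF assms, of P] inv_linear_bij(6)[OF assms]
  by (auto intro: image_eqI[of P "(`) f" "inv f ` P"])

text \<open>With \<open>N\<close> the matrix of the inverse map, the image is described by the
  congruent matrix, transpose of \<open>N\<close> times \<open>A\<close> times
  \<open>N\<close>.\<close>

lemma quadric_image:
  fixes f :: "real^4 \<Rightarrow> real^4"
  assumes f: "linear f" "bij f" and A: "A \<noteq> 0" "transpose A = A"
  obtains B where "B \<noteq> 0" "transpose B = B" "(`) f ` quadric A = quadric B"
proof -
  note g = inv_linear_bij[OF f]
  define N where "N = matrix (inv f)"
  have N: "N *v y = inv f y" for y
    unfolding N_def using matrix_vector_mul(2)[OF g(1)] by (rule fun_cong)
  define B where "B = transpose N ** A ** N"
  have B: "w \<bullet> (B *v y) = inv f w \<bullet> (A *v inv f y)" for w y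
  proof -
    have "w \<bullet> (B *v y) = w \<bullet> (transpose N *v (A *v inv f y))"
      by (simp add: B_def N flip: matrix_vector_mul_assoc)
    also have "\<dots> = ((A *v inv f y) v* N) \<bullet> w"
      by (simp only: transpose_matrix_vector inner_commute)
    also have "\<dots> = inv f w \<bullet> (A *v inv f y)"
      unfolding dot_lmul_matrix N by (rule inner_commute)
    finally show ?thesis .
  qed
  have "B \<noteq> 0"
  proof
    assume "B = 0"
    then have "w \<bullet> (A *v y) = 0" for w y
      using B[of "f w" "f y"] by (simp add: g)
    then have "A *v y = 0" for y
      by (metis inner_eq_zero_iff)
    then show False
      using A(1) by (metis matrix_eq matrix_vector_mult_0)
  qed
  moreover have "transpose B = B"
    by (simp add: B_def A matrix_transpose_mul matrix_mul_assoc)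
  moreover have "P \<in> (`) f ` quadric A \<longleftrightarrow> P \<in> quadric B" for P
  proof -
    have "P \<in> (`) f ` quadric A \<longleftrightarrow> inv f ` P \<in> quadric A"
      by (rule in_image_image_iff[OF f])
    also have "\<dots> \<longleftrightarrow> proj_point P \<and> (\<forall>y\<in>P. y \<bullet> (B *v y) = 0)"
      using proj_image(1)[OF f, of "inv f ` P"] proj_image(1)[OF g(1,2), of P]
      by (auto simp: quadric_def B g(5))
    finally show ?thesis by (simp add: quadric_def)
  qed
  ultimately show thesis
    using that[of B] by blast
qed

lemma hyperboloid_image:
  fixes f :: "real^4 \<Rightarrow> real^4"
  assumes f: "linear f" "bij f" and h: "hyperboloid h"
  shows "hyperboloid ((`) f ` h)"
  unfolding hyperboloid_def
proof (intro conjI ballI)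
  have inj: "inj ((`) f)"
    using f(2) by (simp add: bij_def inj_image_eq_iff inj_def)
  show "\<exists>A. A \<noteq> 0 \<and> transpose A = A \<and> (`) f ` h = quadric A"
    using h quadric_image[OF f] unfolding hyperboloid_def by metis
  show "(`) f ` h \<noteq> {}"
    using h by (simp add: hyperboloid_def)
  fix P assume "P \<in> (`) f ` h"
  then obtain Q where Q: "P = f ` Q" "Q \<in> h" by blast
  have "{l \<in> rulings ((`) f ` h). P \<subseteq> l} = (`) f ` {l \<in> rulings h. Q \<subseteq> l}"
    using f(2) by (auto simp: rulings_image[OF f] Q(1) bij_def inj_image_subset_iff)
  then show "card {l \<in> rulings ((`) f ` h). P \<subseteq> l} = 2"
    using h Q(2) by (simp add: card_image inj_on_subset[OF inj] hyperboloid_def)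
qed

section \<open>The standard doubly ruled quadric\<close>

text \<open>The products of the entries of the unit vectors \<open>(cos u, sin u)\<close> and
  \<open>(cos v, sin v)\<close>, a Clifford torus in the unit 3-sphere. Trigonometric parameters
  reach every point of the projective quadric with a single map on the whole plane, and advancing a
  parameter by \<open>pi/2\<close> amounts to differentiating in it.\<close>

definition torus :: "real \<Rightarrow> real \<Rightarrow> real^4" where
  "torus u v = vector [cos u * cos v, sin u * cos v, sin u * sin v, cos u * sin v]"

lemma sin_cos_shift: "sin (u + pi/2) = cos u" "cos (u + pi/2) = - sin u"
  by (simp_all add: sin_add cos_add)

lemma inner_vec4: "(y :: real^4) \<bullet> z = y$1 * z$1 + y$2 * z$2 + y$3 * z$3 + y$4 * z$4"
  by (simp add: inner_vec_def sum_4)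

lemma inner_torus: "torus u v \<bullet> torus u' v' = cos (u - u') * cos (v - v')"
  by (simp add: torus_def inner_vec4 cos_diff algebra_simps)

text \<open>By \<open>inner_torus\<close> the four vectors with parameters shifted by 0 or
  \<open>pi/2\<close> are orthonormal, so this is the expansion in an orthonormal basis adapted to
  the point \<open>torus u v\<close>.\<close>

lemma torus_expand:
  "z = (z \<bullet> torus u v) *\<^sub>R torus u v + (z \<bullet> torus (u + pi/2) v) *\<^sub>R torus (u + pi/2) v +
     (z \<bullet> torus u (v + pi/2)) *\<^sub>R torus u (v + pi/2) +
     (z \<bullet> torus (u + pi/2) (v + pi/2)) *\<^sub>R torus (u + pi/2) (v + pi/2)"
proof -
  have e: "cos u * cos u = 1 - sin u * sin u" "cos v * cos v = 1 - sin v * sin v"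
    using sin_cos_squared_add3[of u] sin_cos_squared_add3[of v] by linarith+
  show ?thesis
    unfolding vec4_eq_iff inner_vec4 torus_def
    by (simp add: sin_cos_shift, use e in algebra)
qed

text \<open>The form is the determinant of the 2 by 2 matrix with rows \<open>(y$1, y$4)\<close> and
  \<open>(y$2, y$3)\<close>. Passing to the adapted basis rotates this matrix from the left and from
  the right, which keeps the determinant.\<close>

lemma torus_quad:
  assumes "z = a *\<^sub>R torus u v + b *\<^sub>R torus (u + pi/2) v + c *\<^sub>R torus u (v + pi/2) +
     d *\<^sub>R torus (u + pi/2) (v + pi/2)"
  shows "z$1 * z$3 - z$2 * z$4 = a * d - b * c"
proof -
  have e: "cos u * cos u = 1 - sin u * sin u" "cos v * cos v = 1 - sin v * sin v"
    using sin_cos_squared_add3[of u] sin_cos_squared_add3[of v] by linarith+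
  show ?thesis
    unfolding assms torus_def
    by (simp add: sin_cos_shift, use e in algebra)
qed

text \<open>The equation says that the matrix with rows \<open>(y$1, y$4)\<close> and
  \<open>(y$2, y$3)\<close> has rank at most one. It is thus the outer product of
  \<open>(a, b)\<close> and \<open>(c, d)\<close>, and polar coordinates of these two vectors give
  \<open>u\<close>, \<open>v\<close> and the scale. The case split asks whether the first column
  vanishes; if it does not, \<open>c = 1\<close> can be chosen.\<close>

lemma quad_zero_torus:
  fixes y :: "real^4"
  assumes "y$1 * y$3 = y$2 * y$4"
  obtains r u v where "y = r *\<^sub>R torus u v"
proof -
  have "\<exists>a b c d. y$1 = a * c \<and> y$2 = b * c \<and> y$3 = b * d \<and> y$4 = a * d"
  proof (cases "y$1 = 0 \<and> y$2 = 0")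
    case True
    then show ?thesis
      by (intro exI[of _ "y$4"] exI[of _ "y$3"] exI[of _ 0] exI[of _ 1]) simp
  next
    case False
    then consider "y$1 \<noteq> 0" | "y$2 \<noteq> 0" by blast
    then show ?thesis
    proof cases
      case 1
      then show ?thesis using assms
        by (intro exI[of _ "y$1"] exI[of _ "y$2"] exI[of _ 1] exI[of _ "y$4 / y$1"])
          (simp add: field_simps)
    next
      case 2
      then show ?thesis using assms
        by (intro exI[of _ "y$1"] exI[of _ "y$2"] exI[of _ 1] exI[of _ "y$3 / y$2"])
          (simp add: field_simps)
    qed
  qed
  then obtain a b c d where abcd: "y$1 = a * c" "y$2 = b * c" "y$3 = b * d" "y$4 = a * d"
    by blast
  obtain r u where "a = r * cos u" "b = r * sin u"
    using polar_Ex by blast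
  moreover obtain s v where "c = s * cos v" "d = s * sin v"
    using polar_Ex by blast
  ultimately have "y = (r * s) *\<^sub>R torus u v"
    using abcd by (simp add: vec4_eq_iff torus_def)
  then show thesis ..
qed

section \<open>Points and rulings of the standard quadric\<close>

definition std_quadric :: "(real^4) set set" where
  "std_quadric = {P. proj_point P \<and> (\<forall>y\<in>P. y$1 * y$3 = y$2 * y$4)}"

lemma span_in_std_quadric:
  assumes "y \<noteq> 0" "y$1 * y$3 = y$2 * y$4"
  shows "span {y} \<in> std_quadric"
  using assms proj_point_span by (auto simp: std_quadric_def span_singleton)

lemma torus_nonzero: "torus u v \<noteq> 0"
  using inner_torus[of u v u v] by auto

lemma torus_in_std_quadric: "span {torus u v} \<in> std_quadric"
  by (rule span_in_std_quadric[OF torus_nonzero]) (simp add: torus_def)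

lemma std_quadricE:
  assumes "P \<in> std_quadric"
  obtains u v where "P = span {torus u v}"
proof -
  obtain y where y: "y \<noteq> 0" "P = span {y}"
    using assms proj_pointE by (auto simp: std_quadric_def)
  then have "y$1 * y$3 = y$2 * y$4"
    using assms by (auto simp: std_quadric_def span_base)
  then obtain r u v where r: "y = r *\<^sub>R torus u v"
    by (rule quad_zero_torus)
  then have "P = span {torus u v}"
    using y span_singleton_scale[of r] by auto
  then show thesis ..
qed

lemma std_quadric_ruling:
  "span {torus u v, torus (u + pi/2) v} \<in> rulings std_quadric"
  "span {torus u v, torus u (v + pi/2)} \<in> rulings std_quadric"
proof -
  have line: "proj_line (span {a, b})" if "a \<bullet> b = 0" "a \<noteq> 0" "b \<noteq> 0" for a b :: "real^4"
  proof -
    have "independent {a, b}"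
      using that by (intro pairwise_orthogonal_independent) (auto simp: pairwise_def orthogonal_def inner_commute)
    moreover have "a \<noteq> b" using that by auto
    ultimately show ?thesis
      by (simp add: proj_line_def dim_eq_card_independent)
  qed
  have "y$1 * y$3 = y$2 * y$4" if "y \<in> span {torus u v, torus (u + pi/2) v} \<or> y \<in> span {torus u v, torus u (v + pi/2)}" for y
    using that torus_quad[of y _ u v _ 0 0] torus_quad[of y _ u v 0 _ 0]
    unfolding in_span_2 by auto
  then show "span {torus u v, torus (u + pi/2) v} \<in> rulings std_quadric"
    "span {torus u v, torus u (v + pi/2)} \<in> rulings std_quadric"
    by (auto simp: rulings_def points_of_def std_quadric_def inner_torus torus_nonzero intro!: line)
qed

text \<open>A ruling through the point is spanned by it and one further vector \<open>z\<close>. In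
  the adapted basis the quadric equation along the ruling forces \<open>d = 0\<close> and
  \<open>b * c = 0\<close>, which leaves only the two coordinate lines.\<close>

lemma std_quadric_rulings_through:
  "{l \<in> rulings std_quadric. span {torus u v} \<subseteq> l} =
     {span {torus u v, torus (u + pi/2) v}, span {torus u v, torus u (v + pi/2)}}"
proof
  let ?y = "torus u v" and ?yu = "torus (u + pi/2) v" and ?yv = "torus u (v + pi/2)"
  let ?yuv = "torus (u + pi/2) (v + pi/2)"
  show "{span {?y, ?yu}, span {?y, ?yv}} \<subseteq> {l \<in> rulings std_quadric. span {?y} \<subseteq> l}"
    using std_quadric_ruling by (auto intro: span_mono[THEN subsetD, rotated])
  show "{l \<in> rulings std_quadric. span {?y} \<subseteq> l} \<subseteq> {span {?y, ?yu}, span {?y, ?yv}}"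
  proof
    fix l assume "l \<in> {l \<in> rulings std_quadric. span {?y} \<subseteq> l}"
    then have l: "subspace l" "dim l = 2" "points_of l \<subseteq> std_quadric" and y: "?y \<in> l"
      by (auto simp: rulings_def proj_line_def intro: span_base)
    have quad: "w$1 * w$3 = w$2 * w$4" if "w \<in> l" for w
    proof (cases "w = 0")
      case False
      then have "span {w} \<in> points_of l"
        using that l(1) by (auto simp: points_of_def proj_point_span intro: span_minimal[THEN subsetD])
      then show ?thesis
        using l(3) by (auto simp: std_quadric_def span_base)
    qed simp
    have sub: "l = span {?y, w}" if "l \<subseteq> span {?y, w}" for w
      using that l(1,2) dim_le_card[of "span {?y, w}" "{?y, w}"]
      by (intro subspace_dim_equal) (auto simp: card_insert_if split: if_splits)
    have "\<not> l \<subseteq> span {?y}"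
      using dim_subset[of l "span {?y}"] l(2) torus_nonzero by (auto simp: dim_eq_card_independent)
    then obtain z where z: "z \<in> l" "z \<notin> span {?y}" by blast
    obtain a b c d where abcd: "z = a *\<^sub>R ?y + b *\<^sub>R ?yu + c *\<^sub>R ?yv + d *\<^sub>R ?yuv"
      using torus_expand[of z u v] by blast
    have "a * d = b * c"
      using torus_quad[OF abcd] quad[OF z(1)] by simp
    \<comment> \<open>Adding the base point changes only the first coordinate and stays on the
      ruling, so comparison with the previous equation isolates \<open>d\<close>.\<close>
    moreover have "(a + 1) * d = b * c"
    proof -
      have "z + ?y = (a + 1) *\<^sub>R ?y + b *\<^sub>R ?yu + c *\<^sub>R ?yv + d *\<^sub>R ?yuv"
        by (simp add: abcd algebra_simps)
      from torus_quad[OF this] show ?thesis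
        using quad[of "z + ?y"] z(1) y l(1) by (simp add: subspace_add)
    qed
    ultimately have "d = 0" "b = 0 \<or> c = 0"
      by (auto simp: algebra_simps)
    have dim: "l = span {?y, z}"
    proof -
      have "independent {?y, z}" "?y \<noteq> z"
        using z(2) torus_nonzero by (auto simp: independent_insert insert_commute span_base)
      then have "dim {?y, z} = 2"
        by (simp add: dim_eq_card_independent)
      moreover have "span {?y, z} \<subseteq> l"
        using y z(1) l(1) by (intro span_minimal) auto
      ultimately show ?thesis
        using l by (intro subspace_dim_equal[symmetric]) auto
    qed
    have "z \<in> span {?y, ?yu} \<or> z \<in> span {?y, ?yv}"
      using abcd \<open>d = 0\<close> \<open>b = 0 \<or> c = 0\<close> unfolding in_span_2
      by (metis add.right_neutral scale_zero_left)
    have "l \<subseteq> span {?y, ?yu} \<or> l \<subseteq> span {?y, ?yv}"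
    proof -
      have "span {?y, z} \<subseteq> span {?y, w}" if "z \<in> span {?y, w}" for w
        using that by (intro span_minimal) (auto intro: span_base)
      then show ?thesis
        using \<open>z \<in> span {?y, ?yu} \<or> z \<in> span {?y, ?yv}\<close> unfolding dim by blast
    qed
    then show "l \<in> {span {?y, ?yu}, span {?y, ?yv}}"
      using sub by auto
  qed
qed

definition std_matrix :: "real^4^4" where
  "std_matrix = vector [vector [0, 0, 1, 0], vector [0, 0, 0, -1], vector [1, 0, 0, 0], vector [0, -1, 0, 0]]"

lemma std_matrix:
  "std_matrix \<noteq> 0" "transpose std_matrix = std_matrix" "quadric std_matrix = std_quadric"
  "y \<bullet> (std_matrix *v y) = 2 * (y$1 * y$3 - y$2 * y$4)"
proof -
  show "std_matrix \<noteq> 0"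
  proof
    assume "std_matrix = 0"
    then have "std_matrix $ 1 $ 3 = 0" by simp
    then show False by (simp add: std_matrix_def)
  qed
  show "transpose std_matrix = std_matrix"
    by (simp add: vec_eq_iff forall_4 transpose_def std_matrix_def)
  show q: "y \<bullet> (std_matrix *v y) = 2 * (y$1 * y$3 - y$2 * y$4)" for y
    by (simp add: inner_vec4 matrix_vector_mult_def sum_4 std_matrix_def)
  show "quadric std_matrix = std_quadric"
    unfolding quadric_def std_quadric_def q by auto
qed

lemma hyperboloid_std: "hyperboloid std_quadric"
  unfolding hyperboloid_def
proof (intro conjI ballI)
  show "\<exists>A. A \<noteq> 0 \<and> transpose A = A \<and> std_quadric = quadric A"
    using std_matrix by metis
  show "std_quadric \<noteq> {}"
    using torus_in_std_quadric by blast
  fix P assume "P \<in> std_quadric"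
  then obtain u v where P: "P = span {torus u v}"
    by (rule std_quadricE)
  \<comment> \<open>The two rulings through the point differ because this vector is nonzero and
    orthogonal to both generators of the first one.\<close>
  have "torus u (v + pi/2) \<notin> span {torus u v, torus (u + pi/2) v}"
  proof
    assume "torus u (v + pi/2) \<in> span {torus u v, torus (u + pi/2) v}"
    then obtain a b where "torus u (v + pi/2) = a *\<^sub>R torus u v + b *\<^sub>R torus (u + pi/2) v"
      unfolding in_span_2 by blast
    then have "torus u (v + pi/2) \<bullet> torus u (v + pi/2) =
        torus u (v + pi/2) \<bullet> (a *\<^sub>R torus u v + b *\<^sub>R torus (u + pi/2) v)"
      by simp
    also have "\<dots> = 0"
      by (simp add: inner_add_right inner_torus)
    finally have "torus u (v + pi/2) \<bullet> torus u (v + pi/2) = 0" .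
    then show False using torus_nonzero by simp
  qed
  then have "span {torus u v, torus (u + pi/2) v} \<noteq> span {torus u v, torus u (v + pi/2)}"
    by (metis insertI1 insert_commute span_base)
  then show "card {l \<in> rulings std_quadric. P \<subseteq> l} = 2"
    by (simp add: P std_quadric_rulings_through)
qed

section \<open>Asymptotic parametrization\<close>

text \<open>Separating the scalar functions from constant vectors puts the map in a form to which
  derivative and continuity rules apply.\<close>

lemma torus_eq:
  "torus u v = cos v *\<^sub>R (cos u *\<^sub>R vector [1, 0, 0, 0] + sin u *\<^sub>R vector [0, 1, 0, 0]) +
     sin v *\<^sub>R (cos u *\<^sub>R vector [0, 0, 0, 1] + sin u *\<^sub>R vector [0, 0, 1, 0])"
  by (simp add: vec4_eq_iff torus_def)

text \<open>The offset \<open>a\<close> makes the family closed under differentiation: deriving only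
  adds \<open>pi/2\<close> to it.\<close>

lemma torus_derivative_u:
  "((\<lambda>s. torus (s + a) v) has_vector_derivative torus (u + (a + pi/2)) v) (at u)"
proof -
  have "torus (u + (a + pi/2)) v = cos v *\<^sub>R (- sin (u + a) *\<^sub>R vector [1, 0, 0, 0] + cos (u + a) *\<^sub>R vector [0, 1, 0, 0]) +
     sin v *\<^sub>R (- sin (u + a) *\<^sub>R vector [0, 0, 0, 1] + cos (u + a) *\<^sub>R vector [0, 0, 1, 0])"
    unfolding torus_eq add.assoc[symmetric] sin_cos_shift by simp
  then show ?thesis
    unfolding torus_eq by (auto intro!: derivative_eq_intros simp: algebra_simps)
qed

lemma torus_derivative_v:
  "((\<lambda>t. torus u (t + b)) has_vector_derivative torus u (v + (b + pi/2))) (at v)"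
proof -
  have "torus u (v + (b + pi/2)) = - sin (v + b) *\<^sub>R (cos u *\<^sub>R vector [1, 0, 0, 0] + sin u *\<^sub>R vector [0, 1, 0, 0]) +
     cos (v + b) *\<^sub>R (cos u *\<^sub>R vector [0, 0, 0, 1] + sin u *\<^sub>R vector [0, 0, 1, 0])"
    unfolding torus_eq add.assoc[symmetric] sin_cos_shift by simp
  then show ?thesis
    unfolding torus_eq by (auto intro!: derivative_eq_intros simp: algebra_simps)
qed

context
  fixes f :: "real^4 \<Rightarrow> real^4"
  assumes f: "linear f"
begin

lemma linear_torus_derivative_u:
  "((\<lambda>s. f (torus (s + a) v)) has_vector_derivative f (torus (u + (a + pi/2)) v)) (at u)"
  by (rule bounded_linear.has_vector_derivative[OF f[unfolded linear_conv_bounded_linear] torus_derivative_u])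

lemma linear_torus_derivative_v:
  "((\<lambda>t. f (torus u (t + b))) has_vector_derivative f (torus u (v + (b + pi/2)))) (at v)"
  by (rule bounded_linear.has_vector_derivative[OF f[unfolded linear_conv_bounded_linear] torus_derivative_v])

lemma du_torus:
  "du (\<lambda>u v. f (torus (u + a) (v + b))) = (\<lambda>u v. f (torus (u + (a + pi/2)) (v + b)))"
  unfolding du_def by (intro ext, rule vector_derivative_at, rule linear_torus_derivative_u)

lemma dv_torus:
  "dv (\<lambda>u v. f (torus (u + a) (v + b))) = (\<lambda>u v. f (torus (u + a) (v + (b + pi/2))))"
  unfolding dv_def by (intro ext, rule vector_derivative_at, rule linear_torus_derivative_v)

text \<open>Partial derivatives stay in the family with other offsets, so the induction runs with
  \<open>a\<close> and \<open>b\<close> arbitrary.\<close>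

lemma Ck_on_torus: "Ck_on k UNIV (\<lambda>u v. f (torus (u + a) (v + b)))"
proof (induction k arbitrary: a b)
  case 0
  have "continuous_on UNIV (\<lambda>w. torus (fst w + a) (snd w + b))"
    unfolding torus_eq by (intro continuous_intros)
  then have "continuous_on UNIV (\<lambda>w. f (torus (fst w + a) (snd w + b)))"
    using bounded_linear.continuous_on[OF f[unfolded linear_conv_bounded_linear]] by blast
  then show ?case
    by (simp add: case_prod_unfold)
next
  case (Suc k)
  have "(\<lambda>s. f (torus (s + a) (v + b))) differentiable (at u)"
    "(\<lambda>t. f (torus (u + a) (t + b))) differentiable (at v)" for u v
    by (rule differentiableI_vector[OF linear_torus_derivative_u]
      differentiableI_vector[OF linear_torus_derivative_v])+
  then have "\<forall>(u, v)\<in>UNIV. (\<lambda>s. f (torus (s + a) (v + b))) differentiable (at u) \<and>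
      (\<lambda>t. f (torus (u + a) (t + b))) differentiable (at v)"
    by simp
  then show ?case
    unfolding Ck_on.simps du_torus dv_torus by (intro conjI Suc)
qed

lemma torus_tangent_plane:
  "tangent_plane (\<lambda>u v. f (torus u v)) u v =
     f ` span {torus u v, torus (u + pi/2) v, torus u (v + pi/2)}"
  using du_torus[of 0 0] dv_torus[of 0 0]
    linear_span_image[OF f, of "{torus u v, torus (u + pi/2) v, torus u (v + pi/2)}"]
  by (simp add: tangent_plane_def)

lemma asymptotic_torus:
  assumes "inj f"
  shows "asymptotic_parametrization UNIV (\<lambda>u v. f (torus u v)) ((`) f ` std_quadric)"
proof -
  let ?F = "\<lambda>u v. f (torus u v)"
  have "dim (tangent_plane ?F u v) = 3" for u v
  proof -
    let ?S = "{torus u v, torus (u + pi/2) v, torus u (v + pi/2)}"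
    have "independent ?S"
      using torus_nonzero
      by (intro pairwise_orthogonal_independent) (auto simp: pairwise_def orthogonal_def inner_torus)
    moreover have "a \<noteq> b" if "a \<bullet> b = 0" "a \<noteq> 0" for a b :: "real^4"
      using that by auto
    then have "torus u v \<noteq> torus (u + pi/2) v" "torus u v \<noteq> torus u (v + pi/2)"
      "torus (u + pi/2) v \<noteq> torus u (v + pi/2)"
      by (simp_all add: inner_torus torus_nonzero)
    then have "card ?S = 3"
      by simp
    ultimately have "dim ?S = 3"
      by (simp add: dim_eq_card_independent)
    moreover have "dim (tangent_plane ?F u v) = dim (span ?S)"
      unfolding torus_tangent_plane
      by (rule dim_image_eq[OF f inj_on_subset[OF assms subset_UNIV]])
    ultimately show ?thesis by simp
  qed
  moreover have "du (du ?F) u v \<in> tangent_plane ?F u v" "dv (dv ?F) u v \<in> tangent_plane ?F u v" for u v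
  proof -
    \<comment> \<open>Two derivatives in the same parameter make a half turn, so the second
      derivative is the negative of the point itself and lies in the tangent plane.\<close>
    have "torus (u + (pi/2 + pi/2)) v = - torus u v" "torus u (v + (pi/2 + pi/2)) = - torus u v"
      by (simp_all add: torus_def vec4_eq_iff)
    then have "du (du ?F) u v = - f (torus u v)" "dv (dv ?F) u v = - f (torus u v)"
      using du_torus[of 0 0] du_torus[of "pi/2" 0] dv_torus[of 0 0] dv_torus[of 0 "pi/2"] f
      by (simp_all add: linear_neg)
    then show "du (du ?F) u v \<in> tangent_plane ?F u v" "dv (dv ?F) u v \<in> tangent_plane ?F u v"
      unfolding tangent_plane_def by (simp_all only: span_neg span_base insertI1)
  qed
  moreover have "(`) f ` std_quadric = range (\<lambda>w. span {?F (fst w) (snd w)})"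
  proof -
    have "f ` span {w} = span {f w}" for w
      using linear_span_image[OF f, of "{w}"] by simp
    moreover have std: "std_quadric = range (\<lambda>(u, v). span {torus u v})"
    proof
      show "std_quadric \<subseteq> range (\<lambda>(u, v). span {torus u v})"
      proof
        fix P assume "P \<in> std_quadric"
        then obtain u v where "P = span {torus u v}"
          by (rule std_quadricE)
        then show "P \<in> range (\<lambda>(u, v). span {torus u v})"
          by (intro range_eqI[of _ _ "(u, v)"]) simp
      qed
    qed (auto simp: torus_in_std_quadric)
    ultimately show ?thesis
      unfolding std by (simp add: image_image case_prod_unfold)
  qed
  moreover have "smooth_on UNIV ?F"
    using Ck_on_torus[of _ 0 0] by (simp add: smooth_on_def)
  ultimately show ?thesis
    unfolding asymptotic_parametrization_def case_prod_unfold
    by (intro conjI ballI open_UNIV) assumption+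
qed

end

text \<open>Two distinct planes meet in linear dimension at most 2, and two distinct common points
  already span that much.\<close>

lemma tangent_planes_meet:
  assumes "dim A = 3" "dim B = 3" "subspace A" "subspace B" "A \<noteq> B"
    and "a \<in> A \<inter> B" "b \<in> A \<inter> B" "span {a} \<noteq> span {b}" "a \<noteq> 0" "b \<noteq> 0"
  shows "span {a, b} = A \<inter> (B :: (real^4) set)"
proof (rule subspace_dim_equal)
  show "span {a, b} \<subseteq> A \<inter> B"
    using assms by (intro span_minimal subspace_inter) auto
  have "dim (A \<inter> B) < dim A"
  proof (rule ccontr)
    assume "\<not> dim (A \<inter> B) < dim A"
    then have "A \<inter> B = A" "A \<inter> B = B"
      using assms(1-4) by (intro subspace_dim_equal subspace_inter; simp)+
    then show False using assms(5) by blast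
  qed
  moreover have "a \<notin> span {b}"
  proof
    assume "a \<in> span {b}"
    then obtain k where "a = k *\<^sub>R b" unfolding span_singleton by blast
    then show False
      using span_singleton_scale[of k b] assms by auto
  qed
  then have "independent {a, b}" "a \<noteq> b"
    using assms by (auto simp: independent_insert span_base)
  then have "dim {a, b} = 2"
    by (simp add: dim_eq_card_independent)
  ultimately show "dim (A \<inter> B) \<le> dim (span {a, b})"
    using assms(1) by simp
qed (simp_all add: assms subspace_inter)

section \<open>Tangency of corresponding points\<close>

lemma cyclic_add: "i + 1 + 1 = i + (2::4)" "i + 1 + 2 = i + (3::4)" "i + 1 + 3 = (i::4)"
    "i + 2 + 1 = i + (3::4)" "i + 3 + 1 = (i::4)" "i + 3 + 3 = i + (2::4)"
    "i - 1 = i + (3::4)"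
  using exhaust_4[of i] by auto

text \<open>Allows comparison of coefficients starting from an arbitrary vertex, so that conditions
  around vertex \<open>i\<close> are treated uniformly.\<close>

lemma inj_combD_cyclic:
  assumes inj: "inj (comb Y)"
    and eq: "a *\<^sub>R Y i + b *\<^sub>R Y (i + 1) + c *\<^sub>R Y (i + 2) + d *\<^sub>R Y (i + 3) = 0"
  shows "a = 0 \<and> b = 0 \<and> c = 0 \<and> d = 0"
proof -
  consider "i = 1" | "i = 2" | "i = 3" | "i = 4"
    using exhaust_4 by blast
  then show ?thesis
  proof cases
    case 1
    with eq show ?thesis using inj_combD[OF inj, of a b c d] by (simp add: ac_simps)
  next
    case 2
    with eq show ?thesis using inj_combD[OF inj, of d a b c] by (simp add: ac_simps)
  next
    case 3
    with eq show ?thesis using inj_combD[OF inj, of c d a b] by (simp add: ac_simps)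
  next
    case 4
    with eq show ?thesis using inj_combD[OF inj, of b c d a] by (simp add: ac_simps)
  qed
qed

text \<open>
  The coefficient \<open>\<alpha>\<close> occurs twice because of \<open>edge\<close>; the relation for \<open>\<beta>\<close> comes
  from \<open>star'\<close> after cancelling the coefficients \<open>\<alpha>\<close>, which are nonzero by \<open>face\<close>.
\<close>

lemma frame_relation:
  assumes inj: "inj (comb Y)"
    and star: "\<And>i. Yt i \<in> span {Y (i + 3), Y i, Y (i + 1)}"
    and star': "\<And>i. Y i \<in> span {Yt (i + 3), Yt i, Yt (i + 1)}"
    and edge: "\<And>i. Yt i + Yt (i + 1) \<in> span {Y i, Y (i + 1), Y (i + 2) + Y (i + 3)}"
    and face: "\<And>i. Yt i \<notin> span {Y i, Y (i + 1)}"
  obtains \<alpha> \<beta> where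
    "\<And>i. Yt i = \<alpha> i *\<^sub>R Y (i + 3) + \<beta> i *\<^sub>R Y i + \<alpha> (i + 3) *\<^sub>R Y (i + 1)"
    "\<And>i. \<beta> i + \<beta> (i + 2) = 0"
proof -
  have "\<forall>i. \<exists>\<alpha> \<beta> \<gamma>. Yt i = \<alpha> *\<^sub>R Y (i + 3) + \<beta> *\<^sub>R Y i + \<gamma> *\<^sub>R Y (i + 1)"
    using star unfolding in_span_3 by blast
  then obtain \<alpha> \<beta> \<gamma> where Yt: "\<And>i. Yt i = \<alpha> i *\<^sub>R Y (i + 3) + \<beta> i *\<^sub>R Y i + \<gamma> i *\<^sub>R Y (i + 1)"
    by metis
  \<comment> \<open>In \<open>Yt i + Yt (i + 1)\<close> the vectors \<open>Y (i + 2)\<close> and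
    \<open>Y (i + 3)\<close> of the opposite edge have coefficients \<open>\<gamma> (i + 1)\<close>
    and \<open>\<alpha> i\<close>; by \<open>edge\<close> both equal \<open>t\<close>.\<close>
  have \<gamma>: "\<gamma> (i + 1) = \<alpha> i" for i
  proof -
    obtain r s t where "Yt i + Yt (i + 1) = r *\<^sub>R Y i + s *\<^sub>R Y (i + 1) + t *\<^sub>R (Y (i + 2) + Y (i + 3))"
      using edge[of i] unfolding in_span_3 by blast
    then have "(\<beta> i + \<alpha> (i + 1) - r) *\<^sub>R Y i + (\<gamma> i + \<beta> (i + 1) - s) *\<^sub>R Y (i + 1) +
        (\<gamma> (i + 1) - t) *\<^sub>R Y (i + 2) + (\<alpha> i - t) *\<^sub>R Y (i + 3) = 0"
      unfolding Yt cyclic_add by (simp add: algebra_simps)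
    from inj_combD_cyclic[OF inj this] show ?thesis by simp
  qed
  have Yt': "Yt i = \<alpha> i *\<^sub>R Y (i + 3) + \<beta> i *\<^sub>R Y i + \<alpha> (i + 3) *\<^sub>R Y (i + 1)" for i
    using Yt[of i] \<gamma>[of "i + 3"] by (simp add: cyclic_add)
  have \<alpha>: "\<alpha> i \<noteq> 0" for i
  proof
    assume "\<alpha> i = 0"
    then have "Yt i \<in> span {Y i, Y (i + 1)}"
      unfolding in_span_2 using Yt[of i] by auto
    then show False using face by blast
  qed
  have \<beta>: "\<beta> (i + 1) + \<beta> (i + 3) = 0" for i
  proof -
    obtain a b c where "Y i = a *\<^sub>R Yt (i + 3) + b *\<^sub>R Yt i + c *\<^sub>R Yt (i + 1)"
      using star'[of i] unfolding in_span_3 by blast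
    then have "(a * \<alpha> (i + 2) + b * \<beta> i + c * \<alpha> (i + 1) - 1) *\<^sub>R Y i +
        (b * \<alpha> (i + 3) + c * \<beta> (i + 1)) *\<^sub>R Y (i + 1) +
        (a * \<alpha> (i + 3) + c * \<alpha> i) *\<^sub>R Y (i + 2) + (a * \<beta> (i + 3) + b * \<alpha> i) *\<^sub>R Y (i + 3) = 0"
      unfolding Yt' cyclic_add by (simp add: algebra_simps)
    from inj_combD_cyclic[OF inj this]
    have e: "a * \<alpha> (i + 2) + b * \<beta> i + c * \<alpha> (i + 1) = 1"
      "b * \<alpha> (i + 3) + c * \<beta> (i + 1) = 0" "a * \<alpha> (i + 3) + c * \<alpha> i = 0"
      "a * \<beta> (i + 3) + b * \<alpha> i = 0"
      by auto
    \<comment> \<open>With \<open>a = 0\<close> the last two equations give \<open>c = 0\<close> and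
      \<open>b = 0\<close>, contradicting the first.\<close>
    have "a \<noteq> 0"
      using e \<alpha>[of i] by auto
    have "a * \<alpha> (i + 3) * (\<beta> (i + 1) + \<beta> (i + 3)) = 0"
      using e(2-4) by algebra
    then show ?thesis
      using \<open>a \<noteq> 0\<close> \<alpha>[of "i + 3"] by simp
  qed
  have "\<beta> i + \<beta> (i + 2) = 0" for i
    using \<beta>[of "i + 3", unfolded cyclic_add] .
  with Yt' that show thesis by blast
qed

text \<open>
  The vector \<open>torus (u + pi/2) (v + pi/2)\<close> is normal to the tangent plane of the standard quadric
  at \<open>torus u v\<close>; in coordinates it is \<open>(y\<^sub>3, -y\<^sub>4, y\<^sub>1, -y\<^sub>2)\<close>.
\<close>

lemma corresponding_point_in_tangent_plane:
  assumes Yt: "\<And>i. Yt i = \<alpha> i *\<^sub>R Y (i + 3) + \<beta> i *\<^sub>R Y i + \<alpha> (i + 3) *\<^sub>R Y (i + 1)"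
    and \<beta>: "\<And>i. \<beta> i + \<beta> (i + 2) = 0"
  shows "comb Yt (torus u v) \<in> tangent_plane (\<lambda>u v. comb Y (torus u v)) u v"
proof -
  define y where "y = torus u v"
  \<comment> \<open>The coordinates in the basis \<open>Y\<close> of the image point, found by
    substituting \<open>Yt\<close> and collecting terms.\<close>
  define w :: "real^4" where "w = vector
    [\<beta> 1 * y$1 + \<alpha> 2 * y$2 + \<alpha> 3 * y$4, \<alpha> 4 * y$1 + \<beta> 2 * y$2 + \<alpha> 3 * y$3,
     \<alpha> 1 * y$2 + \<beta> 3 * y$3 + \<alpha> 4 * y$4, \<alpha> 1 * y$1 + \<alpha> 2 * y$3 + \<beta> 4 * y$4]"
  have "comb Yt y = comb Y w"
    unfolding comb_def Yt w_def by (simp add: algebra_simps)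
  have n: "torus (u + pi/2) (v + pi/2) = vector [y$3, - y$4, y$1, - y$2]"
    unfolding y_def torus_def by (simp add: vec4_eq_iff sin_cos_shift)
  have "\<beta> 3 = - \<beta> 1" "\<beta> 4 = - \<beta> 2"
    using \<beta>[of 1] \<beta>[of 2] by simp_all
  \<comment> \<open>The terms with \<alpha> cancel in pairs. What is left is \<open>(\<beta> 1 +
    \<beta> 3) * y$1 * y$3 - (\<beta> 2 + \<beta> 4) * y$2 * y$4\<close>, which vanishes because
    opposite \<beta> cancel.\<close>
  then have "w \<bullet> torus (u + pi/2) (v + pi/2) = 0"
    unfolding n inner_vec4 w_def by (simp add: algebra_simps)
  then have "w \<in> span {torus u v, torus (u + pi/2) v, torus u (v + pi/2)}"
    using torus_expand[of w u v] unfolding in_span_3 by auto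
  then show ?thesis
    unfolding torus_tangent_plane[OF linear_comb] using \<open>comb Yt y = comb Y w\<close>
    by (auto simp: y_def)
qed

section \<open>The hyperboloid of a cross\<close>

lemma span_comb:
  "comb Y ` span {z} = span {comb Y z}"
  using linear_span_image[OF linear_comb, of Y "{z}"] by simp

context
  fixes x :: "4 \<Rightarrow> real^3" and p :: "4 \<Rightarrow> (real^4) set" and Y :: "4 \<Rightarrow> real^4"
  assumes frame: "cross_frame x p Y"
begin

lemma frame_inj: "inj (comb Y)" and frame_cross: "p i = span {Y i + Y (i + 1)}"
  using frame by (auto simp: cross_frame_def)

lemmas frame_bij = bij_comb[OF frame_inj]

lemma frame_aff: "aff (x i) = span {Y i}"
  using frame span_singleton_scale unfolding cross_frame_def aff_lift by metis

lemma frame_edge: "inc {aff (x i), aff (x (i + 1))} = span {Y i, Y (i + 1)}"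
  by (simp add: frame_aff inc_points)

lemma frame_quadricI:
  assumes "comb Y z \<noteq> 0" "z$1 * z$3 = z$2 * z$4"
  shows "span {comb Y z} \<in> (`) (comb Y) ` std_quadric"
proof -
  have "z \<noteq> 0" using assms(1) by (auto simp: comb_def)
  then show ?thesis
    using span_in_std_quadric[of z] assms(2) span_comb[of Y z] by (metis image_eqI)
qed

lemma points_in_frame_quadric:
  assumes "\<And>v. v \<in> l \<Longrightarrow> \<exists>z. v = comb Y z \<and> z$1 * z$3 = z$2 * z$4"
  shows "points_of l \<subseteq> (`) (comb Y) ` std_quadric"
proof
  fix P assume "P \<in> points_of l"
  then have P: "proj_point P" "P \<subseteq> l"
    by (auto simp: points_of_def)
  then obtain v where v: "v \<noteq> 0" "P = span {v}"
    by (elim proj_pointE)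
  then have "v \<in> l"
    using P(2) span_base by blast
  then show "P \<in> (`) (comb Y) ` std_quadric"
    using assms v frame_quadricI by metis
qed

lemma frame_hyperboloid:
  defines "h \<equiv> (`) (comb Y) ` std_quadric"
  shows "hyperboloid h" "points_of (inc {aff (x i), aff (x (i + 1))}) \<subseteq> h"
    "points_of (inc {p 1, p 3}) \<subseteq> h" "points_of (inc {p 2, p 4}) \<subseteq> h"
proof -
  show "hyperboloid h"
    unfolding h_def by (rule hyperboloid_image[OF linear_comb frame_bij hyperboloid_std])
  show "points_of (inc {aff (x i), aff (x (i + 1))}) \<subseteq> h"
    unfolding h_def frame_edge
  proof (rule points_in_frame_quadric)
    fix v assume "v \<in> span {Y i, Y (i + 1)}"
    then obtain a b where v: "v = a *\<^sub>R Y i + b *\<^sub>R Y (i + 1)"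
      unfolding in_span_2 by blast
    consider "i = 1" | "i = 2" | "i = 3" | "i = 4"
      using exhaust_4 by blast
    then show "\<exists>z. v = comb Y z \<and> z$1 * z$3 = z$2 * z$4"
    proof cases
      case 1
      with v show ?thesis by (intro exI[of _ "vector [a, b, 0, 0]"]) (simp add: comb_def)
    next
      case 2
      with v show ?thesis by (intro exI[of _ "vector [0, a, b, 0]"]) (simp add: comb_def)
    next
      case 3
      with v show ?thesis by (intro exI[of _ "vector [0, 0, a, b]"]) (simp add: comb_def)
    next
      \<comment> \<open>The edge closes the cycle: its second endpoint is \<open>Y 1\<close>, so
        \<open>b\<close> becomes the first coordinate.\<close>
      case 4
      with v show ?thesis by (intro exI[of _ "vector [b, 0, 0, a]"]) (simp add: comb_def)
    qed
  qed
  show "points_of (inc {p 1, p 3}) \<subseteq> h"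
    unfolding h_def frame_cross inc_points
  proof (rule points_in_frame_quadric)
    fix v assume "v \<in> span {Y 1 + Y (1 + 1), Y 3 + Y (3 + 1)}"
    then obtain a b where v: "v = a *\<^sub>R (Y 1 + Y 2) + b *\<^sub>R (Y 3 + Y 4)"
      unfolding in_span_2 by auto
    then show "\<exists>z. v = comb Y z \<and> z$1 * z$3 = z$2 * z$4"
      by (intro exI[of _ "vector [a, a, b, b]"]) (simp add: comb_def algebra_simps)
  qed
  show "points_of (inc {p 2, p 4}) \<subseteq> h"
    unfolding h_def frame_cross inc_points
  proof (rule points_in_frame_quadric)
    fix v assume "v \<in> span {Y 2 + Y (2 + 1), Y 4 + Y (4 + 1)}"
    then obtain a b where v: "v = a *\<^sub>R (Y 2 + Y 3) + b *\<^sub>R (Y 4 + Y 1)"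
      unfolding in_span_2 by auto
    then show "\<exists>z. v = comb Y z \<and> z$1 * z$3 = z$2 * z$4"
      by (intro exI[of _ "vector [b, a, a, b]"]) (simp add: comb_def algebra_simps)
  qed
qed

text \<open>A symmetric form vanishing along the edges has a Gram matrix in the basis
  \<open>Y\<close> that is zero except for the two pairs of opposite vertices. One line of the cross
  ties these two entries together, so the form is a scalar multiple of the standard one.\<close>

lemma frame_hyperboloid_unique:
  assumes h: "hyperboloid h"
    and edges: "\<And>i. points_of (inc {aff (x i), aff (x (i + 1))}) \<subseteq> h"
    and diagonal: "points_of (inc {p 1, p 3}) \<subseteq> h"
  shows "h = (`) (comb Y) ` std_quadric"
proof -
  obtain A where A: "A \<noteq> 0" "transpose A = A" "h = quadric A"
    using h by (auto simp: hyperboloid_def)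
  define B where "B w y = w \<bullet> (A *v y)" for w y
  have sym: "B w y = B y w" for w y
    unfolding B_def by (metis A(2) dot_lmul_matrix inner_commute transpose_matrix_vector)
  have add: "B (w + y) z = B w z + B y z" "B z (w + y) = B z w + B z y"
    and scale: "B (c *\<^sub>R w) z = c * B w z" "B z (c *\<^sub>R w) = c * B z w" for w y z c
    by (simp_all add: B_def matrix_vector_right_distrib inner_add_left inner_add_right
        matrix_vector_mult_scaleR)
  have zero: "B v v = 0" if "points_of l \<subseteq> h" "subspace l" "v \<in> l" for l v
  proof (cases "v = 0")
    case False
    have "span {v} \<subseteq> l"
      using that by (intro span_minimal) auto
    then have "span {v} \<in> quadric A"
      using that(1) proj_point_span[OF False] by (auto simp: points_of_def A(3))
    then show ?thesis
      by (auto simp: quadric_def B_def span_base)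
  qed (simp add: B_def)
  have edge: "B v v = 0" if "v \<in> span {Y i, Y (i + 1)}" for v i
    using zero[OF edges[of i] _, of v] that by (simp add: frame_edge)
  have Y: "B (Y i) (Y i) = 0" for i
    by (rule edge[of _ i]) (simp add: span_base)
  have Y1: "B (Y i) (Y (i + 1)) = 0" for i
  proof -
    have "B (Y i + Y (i + 1)) (Y i + Y (i + 1)) = 0"
      by (rule edge[of _ i]) (simp add: span_base span_add)
    then show ?thesis
      using sym[of "Y (i + 1)" "Y i"] by (simp add: add Y)
  qed
  have Y12: "B (Y 1) (Y 2) = 0" "B (Y 2) (Y 3) = 0" "B (Y 3) (Y 4) = 0" "B (Y 4) (Y 1) = 0"
    using Y1[of 1] Y1[of 2] Y1[of 3] Y1[of 4] by simp_all
  note Y21 = Y12[unfolded sym[of "Y 1" "Y 2"] sym[of "Y 2" "Y 3"] sym[of "Y 3" "Y 4"] sym[of "Y 4" "Y 1"]]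
  \<comment> \<open>The vector of the cross centre: evaluating the form there leaves only the two
    entries of opposite vertices, whose sum must vanish.\<close>
  have "Y 1 + Y 2 + (Y 3 + Y 4) \<in> span {Y 1 + Y 2, Y 3 + Y 4}"
    by (intro span_add span_base) auto
  then have "B (Y 1 + Y 2 + (Y 3 + Y 4)) (Y 1 + Y 2 + (Y 3 + Y 4)) = 0"
    using zero[OF diagonal] by (simp add: frame_cross inc_points)
  then have Y24: "B (Y 2) (Y 4) = - B (Y 1) (Y 3)"
    using sym[of "Y 3" "Y 1"] sym[of "Y 4" "Y 2"] by (simp add: add Y Y12 Y21)
  have q: "B (comb Y z) (comb Y z) = 2 * B (Y 1) (Y 3) * (z$1 * z$3 - z$2 * z$4)" for z
    using sym[of "Y 3" "Y 1"] sym[of "Y 4" "Y 2"]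
    by (simp add: comb_def add scale Y Y12 Y21 Y24 algebra_simps)
  \<comment> \<open>The scalar cannot be zero, since otherwise the form would vanish identically and
    \<open>A\<close> would be 0.\<close>
  have "B (Y 1) (Y 3) \<noteq> 0"
  proof
    assume "B (Y 1) (Y 3) = 0"
    then have "B y y = 0" for y
      using q[of "inv (comb Y) y"] inv_linear_bij(3)[OF linear_comb frame_bij, of y] by simp
    then show False
      using symmetric_matrix_eq_0[OF A(2)] A(1) by (simp add: B_def)
  qed
  then have q0: "B (comb Y z) (comb Y z) = 0 \<longleftrightarrow> z$1 * z$3 = z$2 * z$4" for z
    by (simp add: q)
  show ?thesis
  proof (rule set_eqI)
    fix P
    note g = inv_linear_bij[OF linear_comb frame_bij]
    have "proj_point P \<longleftrightarrow> proj_point (inv (comb Y) ` P)"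
      using proj_image(1)[OF linear_comb frame_bij, of "inv (comb Y) ` P"]
        proj_image(1)[OF g(1,2), of P] by (auto simp: g(5))
    moreover have "B y y = 0 \<longleftrightarrow> inv (comb Y) y $ 1 * inv (comb Y) y $ 3 =
        inv (comb Y) y $ 2 * inv (comb Y) y $ 4" for y
      using q0[of "inv (comb Y) y"] by (simp add: g(3))
    ultimately have "P \<in> h \<longleftrightarrow> inv (comb Y) ` P \<in> std_quadric"
      by (simp add: A(3) quadric_def std_quadric_def flip: B_def)
    also have "\<dots> \<longleftrightarrow> P \<in> (`) (comb Y) ` std_quadric"
      by (rule in_image_image_iff[OF linear_comb frame_bij, symmetric])
    finally show "P \<in> h \<longleftrightarrow> P \<in> (`) (comb Y) ` std_quadric" .
  qed
qed

lemma cross_hyperboloid_frame: "cross_hyperboloid x p = (`) (comb Y) ` std_quadric"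
  unfolding cross_hyperboloid_def
proof (rule the_equality)
  show "h = (`) (comb Y) ` std_quadric"
    if "hyperboloid h \<and> (\<forall>i. points_of (inc {aff (x i), aff (x (i + 1))}) \<subseteq> h) \<and>
      points_of (inc {p 1, p 3}) \<subseteq> h \<and> points_of (inc {p 2, p 4}) \<subseteq> h" for h
    using that by (intro frame_hyperboloid_unique) simp_all
qed (simp add: frame_hyperboloid)

end

section \<open>Weingarten cubes\<close>

lemma Weingarten_cube_sym:
  assumes "Weingarten_cube x xt p pt"
  shows "Weingarten_cube xt x pt p"
proof -
  \<comment> \<open>Exchanging the two opposite faces lists the vertices of each side face in
    reverse order.\<close>
  have "{a, b, c, d} = {d, c, b, a :: real^3}" for a b c d
    by auto
  then have "A_cube x xt \<Longrightarrow> A_cube xt x"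
    unfolding A_cube_def by metis
  moreover have "inc {p i, pt i} = inc {pt i, p i}" for i
    by (simp add: insert_commute)
  ultimately show ?thesis
    using assms unfolding Weingarten_cube_def by (metis inf_commute)
qed

lemma Weingarten_cube_frame:
  assumes "Weingarten_cube x xt p pt"
  obtains Y where "cross_frame x p Y"
proof (rule cross_frame_exists)
  have nc: "\<not> coplanar {x 1, x 2, x 3, x 4}"
    using assms by (simp add: Weingarten_cube_def A_cube_def)
  show "inj (comb (\<lambda>i. lift (x i)))"
    by (rule inj_combI) (rule not_coplanar_lift[OF nc])
  show "adapted_cross x p"
    using assms by (simp add: Weingarten_cube_def)
qed

text \<open>The planar star of \<open>x i\<close> places \<open>xt i\<close> in the plane of
  \<open>x i\<close> and its two neighbours on the same face; the rest is rescaling of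
  representatives.\<close>

lemma A_cube_star:
  assumes "A_cube x xt" "cross_frame x p Y" "cross_frame xt pt Yt"
  shows "Yt i \<in> span {Y (i + 3), Y i, Y (i + 1)}"
proof -
  obtain c where c: "\<And>i. c i \<noteq> 0" "\<And>i. Y i = c i *\<^sub>R lift (x i)"
    using assms(2) unfolding cross_frame_def by metis
  have in_aff: "lift (x i) \<in> span {Y i}" for i
    using frame_aff[OF assms(2), of i] span_base[of "lift (x i)" "{lift (x i)}"]
    by (simp add: aff_lift)
  have "lift (xt i) \<in> span {lift (x i), lift (x (i - 1)), lift (x (i + 1))}"
  proof (rule coplanar_lift_in_span)
    show "coplanar {x i, x (i - 1), x (i + 1), xt i}"
      using assms(1) by (simp add: A_cube_def)
    fix \<alpha> \<beta> \<gamma>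
    assume "\<alpha> *\<^sub>R lift (x i) + \<beta> *\<^sub>R lift (x (i - 1)) + \<gamma> *\<^sub>R lift (x (i + 1)) = 0"
    \<comment> \<open>Padded with coefficient 0 at the opposite vertex, so that independence of the
      whole frame applies.\<close>
    then have "(\<alpha> / c i) *\<^sub>R Y i + (\<gamma> / c (i + 1)) *\<^sub>R Y (i + 1) + 0 *\<^sub>R Y (i + 2) +
        (\<beta> / c (i + 3)) *\<^sub>R Y (i + 3) = 0"
      using c(1) unfolding c(2) cyclic_add by (simp add: ac_simps)
    from inj_combD_cyclic[OF frame_inj[OF assms(2)] this] show "\<alpha> = 0 \<and> \<beta> = 0 \<and> \<gamma> = 0"
      using c(1) by simp
  qed
  also have "\<dots> \<subseteq> span {Y (i + 3), Y i, Y (i + 1)}"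
    using in_aff span_mono[of "{Y j}" "{Y (i + 3), Y i, Y (i + 1)}" for j]
    unfolding cyclic_add by (intro span_minimal) blast+
  finally have "lift (xt i) \<in> span {Y (i + 3), Y i, Y (i + 1)}" .
  moreover obtain d where "Yt i = d *\<^sub>R lift (xt i)"
    using assms(3) unfolding cross_frame_def by metis
  ultimately show ?thesis
    by (simp add: span_scale)
qed

lemma A_cube_face:
  assumes "A_cube x xt" "cross_frame x p Y" "cross_frame xt pt Yt"
  shows "Yt i \<notin> span {Y i, Y (i + 1)}"
proof
  obtain c where c: "\<And>i. c i \<noteq> 0" "\<And>i. Y i = c i *\<^sub>R lift (x i)"
    using assms(2) unfolding cross_frame_def by metis
  obtain d where d: "d \<noteq> 0" "Yt i = d *\<^sub>R lift (xt i)"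
    using assms(3) unfolding cross_frame_def by metis
  assume "Yt i \<in> span {Y i, Y (i + 1)}"
  then obtain a b where "Yt i = a *\<^sub>R Y i + b *\<^sub>R Y (i + 1)"
    unfolding in_span_2 by blast
  then have "(a * c i) *\<^sub>R lift (x i) + (b * c (i + 1)) *\<^sub>R lift (x (i + 1)) +
      0 *\<^sub>R lift (xt (i + 1)) + (- d) *\<^sub>R lift (xt i) = 0"
    by (simp add: c(2) d(2))
  moreover have "\<not> coplanar {x i, x (i + 1), xt (i + 1), xt i}"
    using assms(1) by (simp add: A_cube_def)
  ultimately show False
    using not_coplanar_lift d(1) by fastforce
qed

text \<open>The vector spans \<open>pt i\<close>, a point of the line in the Weingarten condition,
  and so lies in the plane through the edge of the first face and the cross point on its opposite
  edge.\<close>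

lemma Weingarten_cube_edge:
  assumes "Weingarten_cube x xt p pt" "cross_frame x p Y" "cross_frame xt pt Yt"
  shows "Yt i + Yt (i + 1) \<in> span {Y i, Y (i + 1), Y (i + 2) + Y (i + 3)}"
proof -
  have "Yt i + Yt (i + 1) \<in> inc {p i, pt i}"
    unfolding frame_cross[OF assms(2)] frame_cross[OF assms(3)] inc_points by (simp add: span_base)
  also have "\<dots> \<subseteq> inc {aff (x i), aff (x (i + 1)), p (i + 2)}"
    using assms(1) by (auto simp: Weingarten_cube_def)
  also have "\<dots> = span {Y i, Y (i + 1), Y (i + 2) + Y (i + 3)}"
    unfolding frame_cross[OF assms(2)] frame_aff[OF assms(2)] inc_points cyclic_add ..
  finally show ?thesis .
qed

lemma Weingarten_cube_tangency:
  assumes "Weingarten_cube x xt p pt" "cross_frame x p Y" "cross_frame xt pt Yt"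
  shows "comb Yt (torus u v) \<in> tangent_plane (\<lambda>u v. comb Y (torus u v)) u v"
proof -
  have A: "A_cube x xt" "A_cube xt x"
    using assms(1) Weingarten_cube_sym[OF assms(1)] by (auto simp: Weingarten_cube_def)
  obtain \<alpha> \<beta> where
    "\<And>i. Yt i = \<alpha> i *\<^sub>R Y (i + 3) + \<beta> i *\<^sub>R Y i + \<alpha> (i + 3) *\<^sub>R Y (i + 1)"
    "\<And>i. \<beta> i + \<beta> (i + 2) = 0"
    by (rule frame_relation[OF frame_inj[OF assms(2)] A_cube_star[OF A(1) assms(2,3)]
      A_cube_star[OF A(2) assms(3,2)] Weingarten_cube_edge[OF assms] A_cube_face[OF A(1) assms(2,3)]])
      blast
  then show ?thesis
    by (rule corresponding_point_in_tangent_plane)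
qed

theorem corollary34:
  fixes x xt :: "4 \<Rightarrow> real^3" and p pt :: "4 \<Rightarrow> (real^4) set"
  assumes "Weingarten_cube x xt p pt"
  shows "cross_centre p \<in> cross_hyperboloid x p \<and>
         cross_centre pt \<in> cross_hyperboloid xt pt \<and>
         (\<exists>T. Weingarten_pair (cross_hyperboloid x p) (cross_hyperboloid xt pt) T \<and>
              preserves_rulings (cross_hyperboloid x p) (cross_hyperboloid xt pt) T \<and>
              T (cross_centre p) = cross_centre pt)"
proof -
  obtain Y where Y: "cross_frame x p Y"
    using Weingarten_cube_frame[OF assms] .
  obtain Yt where Yt: "cross_frame xt pt Yt"
    using Weingarten_cube_frame[OF Weingarten_cube_sym[OF assms]] .
  let ?h = "(`) (comb Y) ` std_quadric" and ?ht = "(`) (comb Yt) ` std_quadric"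
  have h: "cross_hyperboloid x p = ?h" "cross_hyperboloid xt pt = ?ht"
    using cross_hyperboloid_frame Y Yt by auto
  note inj = frame_inj[OF Y] frame_inj[OF Yt]
  note bij = frame_bij[OF Y] frame_bij[OF Yt]
  note g = inv_linear_bij[OF linear_comb bij(1)]
  have nonzero: "comb Y (torus u v) \<noteq> 0" "comb Yt (torus u v) \<noteq> 0" for u v
    using inj torus_nonzero unfolding linear_injective_0[OF linear_comb] by blast+
  have centre: "cross_centre p \<in> ?h" "cross_centre pt \<in> ?ht"
  proof -
    have "vector [1, 1, 1, 1] \<noteq> (0 :: real^4)"
      by (simp add: vec4_eq_iff)
    then have "span {vector [1, 1, 1, 1]} \<in> std_quadric"
      by (rule span_in_std_quadric) simp
    then show "cross_centre p \<in> ?h" "cross_centre pt \<in> ?ht"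
      unfolding cross_frame_centre[OF Y] cross_frame_centre[OF Yt] span_comb[symmetric]
      by (simp_all only: imageI)
  qed
  \<comment> \<open>The linear map taking the frame \<open>Y\<close> to \<open>Yt\<close>. It
    preserves frame coordinates, so it matches equal parameters of the two surfaces and sends the
    centre \<open>(1, 1, 1, 1)\<close> to the centre.\<close>
  define f where "f = comb Yt \<circ> inv (comb Y)"
  have f_comb: "f (comb Y z) = comb Yt z" for z
    by (simp add: f_def g(4))
  have f: "linear f" "bij f"
    unfolding f_def using linear_compose[OF g(1) linear_comb] bij_comp[OF g(2) bij(2)] by auto
  have f_span: "f ` span {comb Y z} = span {comb Yt z}" for z
    using linear_span_image[OF f(1), of "{comb Y z}"] by (simp add: f_comb)
  have f_h: "(`) f ` ?h = ?ht"
    by (simp add: image_image f_comb)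
  let ?F = "\<lambda>u v. comb Y (torus u v)" and ?Ft = "\<lambda>u v. comb Yt (torus u v)"
  have param: "asymptotic_parametrization UNIV ?F ?h" "asymptotic_parametrization UNIV ?Ft ?ht"
    by (rule asymptotic_torus[OF linear_comb inj(1)] asymptotic_torus[OF linear_comb inj(2)])+
  have meet: "inc {span {?F u v}, span {?Ft u v}} = tangent_plane ?F u v \<inter> tangent_plane ?Ft u v"
    if "span {?F u v} \<noteq> span {?Ft u v}" "tangent_plane ?F u v \<noteq> tangent_plane ?Ft u v" for u v
    unfolding inc_points
  proof (rule tangent_planes_meet)
    show "dim (tangent_plane ?F u v) = 3" "dim (tangent_plane ?Ft u v) = 3"
      using param unfolding asymptotic_parametrization_def by auto
    show "subspace (tangent_plane ?F u v)" "subspace (tangent_plane ?Ft u v)"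
      by (simp_all add: tangent_plane_def)
    have "?F u v \<in> tangent_plane ?F u v" "?Ft u v \<in> tangent_plane ?Ft u v"
      by (simp_all add: tangent_plane_def span_base)
    \<comment> \<open>Tangency is used twice, the second time for the cube with its two faces
      exchanged, so each of the corresponding points lies in both tangent planes.\<close>
    then show "?F u v \<in> tangent_plane ?F u v \<inter> tangent_plane ?Ft u v"
      "?Ft u v \<in> tangent_plane ?F u v \<inter> tangent_plane ?Ft u v"
      using Weingarten_cube_tangency[OF assms Y Yt]
        Weingarten_cube_tangency[OF Weingarten_cube_sym[OF assms] Yt Y] by blast+
  qed (use that nonzero in auto)
  have "inj ((`) f)"
    using f(2) by (simp add: bij_def inj_image_eq_iff inj_def)
  then have "bij_betw ((`) f) ?h ?ht"
    using f_h by (auto simp: bij_betw_def intro: inj_on_subset)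
  moreover have "\<forall>(u, v)\<in>UNIV. f ` span {?F u v} = span {?Ft u v} \<and>
           (span {?F u v} \<noteq> span {?Ft u v} \<and> tangent_plane ?F u v \<noteq> tangent_plane ?Ft u v \<longrightarrow>
              inc {span {?F u v}, span {?Ft u v}} = tangent_plane ?F u v \<inter> tangent_plane ?Ft u v)"
    using meet f_span by blast
  ultimately have "Weingarten_pair ?h ?ht ((`) f)"
    using param unfolding Weingarten_pair_def by blast
  moreover have "preserves_rulings ?h ?ht ((`) f)"
    unfolding preserves_rulings_def f_h[symmetric] rulings_image[OF f]
    using points_of_image[OF f] by blast
  moreover have "f ` cross_centre p = cross_centre pt"
    unfolding cross_frame_centre[OF Y] cross_frame_centre[OF Yt] by (rule f_span)
  ultimately show ?thesis
    unfolding h using centre by blast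
qed

end
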